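(* Let $\mathbb F$ be a field, $d\ge1$ an integer, $A=A(d,\mathbb F)$, and let $F=\sum_{n=0}^\infty(A_{n+1}\cap A^*_{n+1})\subseteq A$. Each of the $\mathbb F$-linear maps $$F\otimes A_1\to A,\quad u\otimes v\mapsto uv,\qquad\text{and}\qquad F\otimes A^*_1\to A,\quad u\otimes v\mapsto uv,$$ is an isomorphism of $\mathbb F$-vector spaces. (Tensor products are over $\mathbb F$.)
   Context: Algebras are associative and have a $1$. For a field $\mathbb F$ and an integer $d\ge 1$, $A=A(d,\mathbb F)$ is the $\mathbb F$-algebra defined by generators $\{e_i\}_{i=0}^d$, $\{e^*_i\}_{i=0}^d$ and relations $e_ie_j=\delta_{i,j}e_i$, $e^*_ie^*_j=\delta_{i,j}e^*_i$ $(0\le i,j\le d)$, $1=\sum_{i=0}^d e_i$, $1=\sum_{i=0}^d e^*_i$. The $e_i,e_i^*$ are the idempotent generators; the $e^*_i$ are called starred and the $e_i$ nonstarred; $i$ is the index of $e_i$ and of $e^*_i$. There is a unique $\mathbb F$-algebra automorphism $*$ of $A$, written $x\mapsto x^*$, that swaps $e_i$ and $e^*_i$ for $0\le i\le d$. For $n\ge1$, a word of length $n$ in $A$ is a product $g_1g_2\cdots g_n$ of idempotent generators such that for $2\le j\le n$ exactly one of $g_{j-1},g_j$ is starred. It ends with $g_n$. The word is nonrepeating (NR) if $g_{j-1},g_j$ have different indices for $2\le j\le n$. For $n\ge1$, $A_n$ is the subspace of $A$ spanned by the NR words that have length $n$ and end with a nonstarred element, and $A^*_n$ is the image of $A_n$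 under $*$. In particular $A_1=\mathrm{span}\{e_0,\dots,e_d\}$ and $A_1^*=\mathrm{span}\{e^*_0,\dots,e^*_d\}$. The subspace $F$ is a subalgebra of $A$; it is the image of the injective algebra homomorphism from the free $\mathbb F$-algebra on $s_1,\dots,s_d$ to $A$ sending $s_i\mapsto e_i-e_i^*$, and the free algebra is identified with this image. *)

theory Defs
  imports Complex_Main "HOL-Library.Poly_Mapping"
begin

section \<open>Finitely supported linear combinations\<close>

text \<open>Formal linear combinations over a field are the finitely supported functions
  \<open>'x \<Rightarrow>\<^sub>0 'f\<close>; \<open>Poly_Mapping.single x 1\<close> is the basis vector of \<open>x\<close>.\<close>

definition fscale :: "'f::field \<Rightarrow> ('x \<Rightarrow>\<^sub>0 'f) \<Rightarrow> ('x \<Rightarrow>\<^sub>0 'f)" where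
  "fscale c p = Poly_Mapping.map ((*) c) p"

definition lin_ext :: "('f::field \<Rightarrow> 'b \<Rightarrow> 'b) \<Rightarrow> ('x \<Rightarrow> 'b) \<Rightarrow> ('x \<Rightarrow>\<^sub>0 'f) \<Rightarrow> 'b::ab_group_add" where
  "lin_ext scl f p = (\<Sum>x\<in>Poly_Mapping.keys p. scl (Poly_Mapping.lookup p x) (f x))"

lemma lookup_fscale [simp]: "Poly_Mapping.lookup (fscale c p) x = c * Poly_Mapping.lookup p x"
  unfolding fscale_def by transfer (auto simp: when_def)

lemma vector_space_fscale: "vector_space fscale"
  by unfold_locales (auto intro!: poly_mapping_eqI simp: lookup_add algebra_simps)

lemma fscale_zero_left [simp]: "fscale 0 p = 0"
  by (auto intro!: poly_mapping_eqI)

lemma fscale_single [simp]: "fscale c (Poly_Mapping.single x a) = Poly_Mapping.single x (c * a)"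
  by (auto intro!: poly_mapping_eqI simp: lookup_single when_def)

lemma fscale_conv_mult: "fscale c p = Poly_Mapping.single 0 c * p"
  for p :: "'x::monoid_add \<Rightarrow>\<^sub>0 'f::field"
  by (simp add: fscale_def mult_map_scale_conv_mult)

lemma fscale_mult_left: "fscale c p * q = fscale c (p * q)"
  for p q :: "'x::monoid_add \<Rightarrow>\<^sub>0 'f::field"
  by (simp add: fscale_conv_mult mult.assoc)

lemma single_central: "Poly_Mapping.single 0 c * p = p * Poly_Mapping.single 0 c"
  for p :: "'x::monoid_add \<Rightarrow>\<^sub>0 'f::field"
proof (induction p rule: update_induct)
  case const
  show ?case by simp
next
  case (update p a b)
  have "Poly_Mapping.update a b p = p + Poly_Mapping.single a b"
    using update by (auto intro!: poly_mapping_eqI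
        simp: lookup_update lookup_add lookup_single when_def in_keys_iff)
  then show ?case using update
    by (simp add: algebra_simps mult_single)
qed

lemma fscale_mult_right: "p * fscale c q = fscale c (p * q)"
  for p q :: "'x::monoid_add \<Rightarrow>\<^sub>0 'f::field"
  by (metis fscale_conv_mult mult.assoc single_central)

lemma lin_ext_eq_sum:
  assumes "vector_space scl" "finite S" "Poly_Mapping.keys p \<subseteq> S"
  shows "lin_ext scl f p = (\<Sum>x\<in>S. scl (Poly_Mapping.lookup p x) (f x))"
proof -
  interpret vector_space scl by fact
  show ?thesis unfolding lin_ext_def
    by (rule sum.mono_neutral_left) (use assms in \<open>auto simp: in_keys_iff\<close>)
qed

lemma lin_ext_add:
  assumes "vector_space scl"
  shows "lin_ext scl f (p + q) = lin_ext scl f p + lin_ext scl f q"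
proof -
  interpret vector_space scl by fact
  let ?S = "Poly_Mapping.keys p \<union> Poly_Mapping.keys q"
  have "Poly_Mapping.keys (p + q) \<subseteq> ?S" by (rule keys_add)
  then show ?thesis
    by (simp add: lin_ext_eq_sum[OF assms, of ?S] lookup_add scale_left_distrib sum.distrib)
qed

lemma lin_ext_single:
  assumes "vector_space scl"
  shows "lin_ext scl f (Poly_Mapping.single x c) = scl c (f x)"
proof -
  interpret vector_space scl by fact
  show ?thesis by (simp add: lin_ext_eq_sum[OF assms, of "{x}"])
qed

lemma lin_ext_zero [simp]: "lin_ext scl f 0 = 0"
  by (simp add: lin_ext_def)

lemma lin_ext_scale:
  assumes "vector_space scl"
  shows "lin_ext scl f (fscale c p) = scl c (lin_ext scl f p)"
proof -
  interpret vector_space scl by fact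
  have "Poly_Mapping.keys (fscale c p) \<subseteq> Poly_Mapping.keys p"
    by (auto simp: in_keys_iff)
  then show ?thesis
    by (simp add: lin_ext_eq_sum[OF assms, of "Poly_Mapping.keys p"] scale_sum_right)
qed

lemma lin_ext_diff:
  assumes "vector_space scl"
  shows "lin_ext scl f (p - q) = lin_ext scl f p - lin_ext scl f q"
  using lin_ext_add[OF assms, of f "p - q" q] by simp

lemma lin_ext_sum:
  assumes "vector_space scl"
  shows "lin_ext scl f (sum g S) = (\<Sum>s\<in>S. lin_ext scl f (g s))"
  by (induction S rule: infinite_finite_induct) (simp_all add: lin_ext_add[OF assms])

lemma lin_ext_mult:
  fixes scl :: "'f::field \<Rightarrow> 'b::ring_1 \<Rightarrow> 'b" and f :: "'x::monoid_add \<Rightarrow> 'b"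
  assumes vs: "vector_space scl"
    and l: "\<And>c a b. scl c a * b = scl c (a * b)"
    and r: "\<And>c a b. a * scl c b = scl c (a * b)"
    and f: "\<And>x y. f (x + y) = f x * f y"
  shows "lin_ext scl f (p * q) = lin_ext scl f p * lin_ext scl f q"
proof (induction p rule: update_induct)
  case const
  show ?case by simp
next
  case (update p a c)
  have p: "Poly_Mapping.update a c p = p + Poly_Mapping.single a c"
    using update by (auto intro!: poly_mapping_eqI
        simp: lookup_update lookup_add lookup_single when_def in_keys_iff)
  interpret vector_space scl by fact
  have "lin_ext scl f (Poly_Mapping.single a c * q) = scl c (f a) * lin_ext scl f q"
  proof (induction q rule: update_induct)
    case const
    show ?case by simp
  next
    case (update q b e)
    have "Poly_Mapping.update b e q = q + Poly_Mapping.single b e"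
      using update by (auto intro!: poly_mapping_eqI
          simp: lookup_update lookup_add lookup_single when_def in_keys_iff)
    then show ?case using update
      by (simp add: distrib_left mult_single lin_ext_add[OF vs] lin_ext_single[OF vs] f l r)
  qed
  then show ?case using update
    by (simp add: p distrib_right lin_ext_add[OF vs] lin_ext_single[OF vs])
qed


section \<open>The free algebra\<close>

datatype 'g word = Word (letters: "'g list")

instantiation word :: (type) monoid_add
begin
definition "0 = Word []"
definition "v + w = Word (letters v @ letters w)"
instance by standard (simp_all add: zero_word_def plus_word_def)
end

lemma letters_zero: "letters 0 = []"
  by (simp add: zero_word_def)

text \<open>\<open>E i\<close> and \<open>Es i\<close> stand for the free generators \<open>e\<^sub>i\<close> and \<open>e\<^sup>*\<^sub>i\<close>. The index set
  \<open>{0..d}\<close> is rendered as a finite type \<open>'i\<close> with \<open>d + 1\<close> elements.\<close>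

datatype 'i gen = E (index: 'i) | Es (index: 'i)

primrec starred :: "'i gen \<Rightarrow> bool" where
  "starred (E i) = False"
| "starred (Es i) = True"

primrec swap_gen :: "'i gen \<Rightarrow> 'i gen" where
  "swap_gen (E i) = Es i"
| "swap_gen (Es i) = E i"

type_synonym ('i, 'f) free_alg = "'i gen word \<Rightarrow>\<^sub>0 'f"

definition free_gen :: "'i gen \<Rightarrow> ('i, 'f::field) free_alg" where
  "free_gen g = Poly_Mapping.single (Word [g]) 1"

definition free_swap :: "('i, 'f::field) free_alg \<Rightarrow> ('i, 'f) free_alg" where
  "free_swap = lin_ext fscale (\<lambda>w. Poly_Mapping.single (Word (map swap_gen (letters w))) 1)"


section \<open>The algebra A(d,F)\<close>

inductive_set two_sided_ideal :: "'a::ring_1 set \<Rightarrow> 'a set" for R where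
  gen: "r \<in> R \<Longrightarrow> r \<in> two_sided_ideal R"
| zero: "0 \<in> two_sided_ideal R"
| add: "x \<in> two_sided_ideal R \<Longrightarrow> y \<in> two_sided_ideal R \<Longrightarrow> x + y \<in> two_sided_ideal R"
| lmult: "x \<in> two_sided_ideal R \<Longrightarrow> a * x \<in> two_sided_ideal R"
| rmult: "x \<in> two_sided_ideal R \<Longrightarrow> x * a \<in> two_sided_ideal R"

definition relators :: "('i::finite, 'f::field) free_alg set" where
  "relators =
     {free_gen (E i) * free_gen (E j) - (if i = j then free_gen (E i) else 0) | i j. True} \<union>
     {free_gen (Es i) * free_gen (Es j) - (if i = j then free_gen (Es i) else 0) | i j. True} \<union>
     {1 - (\<Sum>i\<in>UNIV. free_gen (E i)), 1 - (\<Sum>i\<in>UNIV. free_gen (Es i))}"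

lemma relators_E_mult:
  "free_gen (E i) * free_gen (E j) - (if i = j then free_gen (E i) else 0) \<in> relators"
  unfolding relators_def by (rule UnI1, rule UnI1, rule CollectI, rule exI[of _ i], rule exI[of _ j], simp)

lemma relators_Es_mult:
  "free_gen (Es i) * free_gen (Es j) - (if i = j then free_gen (Es i) else 0) \<in> relators"
  unfolding relators_def by (rule UnI1, rule UnI2, rule CollectI, rule exI[of _ i], rule exI[of _ j], simp)

lemma relators_E_sum: "1 - (\<Sum>i\<in>UNIV. free_gen (E i)) \<in> relators"
  unfolding relators_def by (rule UnI2, rule insertI1)

lemma relators_Es_sum: "1 - (\<Sum>i\<in>UNIV. free_gen (Es i)) \<in> relators"
  unfolding relators_def by (rule UnI2, rule insertI2, rule insertI1)

definition alg_cong :: "('i::finite, 'f::field) free_alg \<Rightarrow> ('i, 'f) free_alg \<Rightarrow> bool" where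
  "alg_cong p q \<longleftrightarrow> p - q \<in> two_sided_ideal relators"

lemma two_sided_ideal_uminus: "x \<in> two_sided_ideal R \<Longrightarrow> - x \<in> two_sided_ideal R"
  using two_sided_ideal.lmult[of x R "- 1"] by simp

lemma two_sided_ideal_diff:
  "x \<in> two_sided_ideal R \<Longrightarrow> y \<in> two_sided_ideal R \<Longrightarrow> x - y \<in> two_sided_ideal R"
  using two_sided_ideal.add[of x R "- y"] two_sided_ideal_uminus[of y R] by simp

lemma equivp_alg_cong: "equivp (alg_cong :: ('i::finite, 'f::field) free_alg \<Rightarrow> _)"
  (is "equivp ?R")
proof (rule equivpI)
  show "reflp ?R"
    by (auto simp: reflp_def alg_cong_def two_sided_ideal.zero)
  show "symp ?R"
  proof (rule sympI)
    fix p q :: "('i, 'f) free_alg"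
    assume "alg_cong p q"
    then show "alg_cong q p"
      using two_sided_ideal_uminus[of "p - q" relators] by (simp add: alg_cong_def)
  qed
  show "transp ?R"
  proof (rule transpI)
    fix p q r :: "('i, 'f) free_alg"
    assume "alg_cong p q" "alg_cong q r"
    then show "alg_cong p r"
      using two_sided_ideal.add[of "p - q" relators "q - r"] by (simp add: alg_cong_def)
  qed
qed

quotient_type (overloaded) ('i, 'f) alg = "('i::finite, 'f::field) free_alg" / alg_cong
  by (rule equivp_alg_cong)

text \<open>The algebra is nontrivial: sending \<open>e\<^sub>i\<close> and \<open>e\<^sup>*\<^sub>i\<close> to \<open>\<delta>\<close>-values at a fixed index respects
  all relations. This is needed because \<open>ring_1\<close> includes \<open>0 \<noteq> 1\<close>.\<close>

lemma one_notin_ideal: "(1 :: ('i::finite, 'f::field) free_alg) \<notin> two_sided_ideal relators"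
proof
  define k :: 'i where "k = undefined"
  define h :: "'i gen word \<Rightarrow> 'f"
    where "h w = prod_list (map (\<lambda>g. if index g = k then 1 else 0) (letters w))" for w
  define \<phi> where "\<phi> = lin_ext (*) h"
  have vs: "vector_space ((*) :: 'f \<Rightarrow> 'f \<Rightarrow> 'f)"
    by unfold_locales (auto simp: algebra_simps)
  have mult: "\<phi> (p * q) = \<phi> p * \<phi> q" for p q
    unfolding \<phi>_def by (rule lin_ext_mult[OF vs]) (auto simp: h_def plus_word_def)
  have add: "\<phi> (p + q) = \<phi> p + \<phi> q" for p q
    unfolding \<phi>_def by (rule lin_ext_add[OF vs])
  have diff: "\<phi> (p - q) = \<phi> p - \<phi> q" for p q
    unfolding \<phi>_def by (rule lin_ext_diff[OF vs])
  have sum: "\<phi> (sum g S) = (\<Sum>s\<in>S. \<phi> (g s))" for g and S :: "'i set"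
    unfolding \<phi>_def by (rule lin_ext_sum[OF vs])
  have zero: "\<phi> 0 = 0" by (simp add: \<phi>_def)
  have one: "\<phi> 1 = 1"
    unfolding \<phi>_def
    using lin_ext_single[OF vs, of h 0 1] by (simp add: h_def letters_zero)
  have gen: "\<phi> (free_gen g) = (if index g = k then 1 else 0)" for g
    unfolding \<phi>_def free_gen_def by (simp add: lin_ext_single[OF vs] h_def)
  have "\<phi> r = 0" if "r \<in> relators" for r
    using that unfolding relators_def
    by (auto simp: diff mult gen zero one sum)
  note rel = this
  have "\<phi> x = 0" if "x \<in> two_sided_ideal relators" for x
    using that by induction (auto simp: rel zero add mult)
  moreover assume "1 \<in> two_sided_ideal (relators :: ('i, 'f) free_alg set)"
  ultimately show False using one by fastforce
qed

instantiation alg :: (finite, field) ring_1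
begin

lift_definition zero_alg :: "('a, 'b) alg" is 0 .
lift_definition one_alg :: "('a, 'b) alg" is 1 .
lift_definition plus_alg :: "('a, 'b) alg \<Rightarrow> ('a, 'b) alg \<Rightarrow> ('a, 'b) alg" is "(+)"
  unfolding alg_cong_def add_diff_add by (rule two_sided_ideal.add)
lift_definition uminus_alg :: "('a, 'b) alg \<Rightarrow> ('a, 'b) alg" is uminus
  unfolding alg_cong_def minus_diff_minus by (rule two_sided_ideal_uminus)
lift_definition minus_alg :: "('a, 'b) alg \<Rightarrow> ('a, 'b) alg \<Rightarrow> ('a, 'b) alg" is "(-)"
proof -
  fix p p' q q' :: "('a, 'b) free_alg"
  assume "alg_cong p p'" "alg_cong q q'"
  moreover have "p - q - (p' - q') = (p - p') - (q - q')"
    by simp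
  ultimately show "alg_cong (p - q) (p' - q')"
    unfolding alg_cong_def by (simp only: two_sided_ideal_diff)
qed
lift_definition times_alg :: "('a, 'b) alg \<Rightarrow> ('a, 'b) alg \<Rightarrow> ('a, 'b) alg" is "(*)"
proof -
  fix p p' q q' :: "('a, 'b) free_alg"
  assume "alg_cong p p'" "alg_cong q q'"
  moreover have "p * q - p' * q' = (p - p') * q + p' * (q - q')"
    by (simp add: algebra_simps)
  ultimately show "alg_cong (p * q) (p' * q')"
    unfolding alg_cong_def by (simp add: two_sided_ideal.intros)
qed

lemma alg_cong_refl: "alg_cong p p"
  by (simp add: alg_cong_def two_sided_ideal.zero)

instance
proof
  fix a b c :: "('a, 'b) alg"
  show "a + b + c = a + (b + c)"
    by transfer (simp add: algebra_simps alg_cong_refl)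
  show "a + b = b + a"
    by transfer (simp add: algebra_simps alg_cong_refl)
  show "0 + a = a"
    by transfer (simp add: algebra_simps alg_cong_refl)
  show "- a + a = 0"
    by transfer (simp add: algebra_simps alg_cong_refl)
  show "a - b = a + - b"
    by transfer (simp add: algebra_simps alg_cong_refl)
  show "a * b * c = a * (b * c)"
    by transfer (simp add: algebra_simps alg_cong_refl)
  show "1 * a = a"
    by transfer (simp add: algebra_simps alg_cong_refl)
  show "a * 1 = a"
    by transfer (simp add: algebra_simps alg_cong_refl)
  show "(a + b) * c = a * c + b * c"
    by transfer (simp add: algebra_simps alg_cong_refl)
  show "a * (b + c) = a * b + a * c"
    by transfer (simp add: algebra_simps alg_cong_refl)
  show "(0 :: ('a, 'b) alg) \<noteq> 1"
  proof
    assume "(0 :: ('a, 'b) alg) = 1"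
    then have "0 - 1 \<in> two_sided_ideal (relators :: ('a, 'b) free_alg set)"
      unfolding zero_alg_def one_alg_def alg.abs_eq_iff alg_cong_def .
    then have "- (0 - 1) \<in> two_sided_ideal (relators :: ('a, 'b) free_alg set)"
      by (rule two_sided_ideal_uminus)
    then show False
      by (simp add: one_notin_ideal)
  qed
qed

end

lift_definition ascale :: "'f::field \<Rightarrow> ('i::finite, 'f) alg \<Rightarrow> ('i, 'f) alg" is fscale
proof -
  fix c :: 'f and p q :: "('i, 'f) free_alg"
  assume "alg_cong p q"
  moreover have "fscale c p - fscale c q = Poly_Mapping.single 0 c * (p - q)"
    by (simp add: fscale_conv_mult algebra_simps)
  ultimately show "alg_cong (fscale c p) (fscale c q)"
    unfolding alg_cong_def by (simp add: two_sided_ideal.lmult)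
qed

lemma vector_space_ascale:
  "vector_space (ascale :: 'f::field \<Rightarrow> ('i::finite, 'f) alg \<Rightarrow> ('i, 'f) alg)"
proof -
  interpret F: vector_space "fscale :: 'f \<Rightarrow> ('i, 'f) free_alg \<Rightarrow> _"
    by (rule vector_space_fscale)
  show ?thesis
  proof
    fix a b :: 'f and x y :: "('i, 'f) alg"
    show "ascale a (x + y) = ascale a x + ascale a y"
      by transfer (simp add: F.scale_right_distrib alg_cong_refl)
    show "ascale (a + b) x = ascale a x + ascale b x"
      by transfer (simp add: F.scale_left_distrib alg_cong_refl)
    show "ascale a (ascale b x) = ascale (a * b) x"
      by transfer (simp add: alg_cong_refl)
    show "ascale 1 x = x"
      by transfer (simp add: alg_cong_refl)
  qed
qed

lemma ascale_mult_left: "ascale c x * y = ascale c (x * y)"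
  by transfer (simp add: fscale_mult_left alg_cong_refl)

lemma ascale_mult_right: "x * ascale c y = ascale c (x * y)"
  by transfer (simp add: fscale_mult_right alg_cong_refl)

lift_definition agen :: "'i gen \<Rightarrow> ('i::finite, 'f::field) alg" is free_gen .

lemma agen_E_mult:
  "agen (E i) * agen (E j) = (if i = j then agen (E i) else (0 :: ('i::finite, 'f::field) alg))"
proof -
  have "abs_alg (free_gen (E i) * free_gen (E j)) =
      abs_alg (if i = j then free_gen (E i) else (0 :: ('i, 'f) free_alg))"
    unfolding alg.abs_eq_iff alg_cong_def
    by (rule two_sided_ideal.gen) (rule relators_E_mult)
  also have "\<dots> = (if i = j then agen (E i) else 0)"
    by (cases "i = j") (simp_all only: agen.abs_eq zero_alg_def if_True if_False simp_thms)
  finally show ?thesis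
    by (simp only: agen.abs_eq times_alg.abs_eq)
qed

lemma agen_Es_mult:
  "agen (Es i) * agen (Es j) = (if i = j then agen (Es i) else (0 :: ('i::finite, 'f::field) alg))"
proof -
  have "abs_alg (free_gen (Es i) * free_gen (Es j)) =
      abs_alg (if i = j then free_gen (Es i) else (0 :: ('i, 'f) free_alg))"
    unfolding alg.abs_eq_iff alg_cong_def
    by (rule two_sided_ideal.gen) (rule relators_Es_mult)
  also have "\<dots> = (if i = j then agen (Es i) else 0)"
    by (cases "i = j") (simp_all only: agen.abs_eq zero_alg_def if_True if_False simp_thms)
  finally show ?thesis
    by (simp only: agen.abs_eq times_alg.abs_eq)
qed

lemma abs_alg_sum: "abs_alg (sum f S) = (\<Sum>i\<in>S. abs_alg (f i))"
  by (induction S rule: infinite_finite_induct)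
    (simp_all add: zero_alg_def[symmetric] plus_alg.abs_eq[symmetric])

lemma sum_agen_E: "(\<Sum>i\<in>UNIV. agen (E i)) = (1 :: ('i::finite, 'f::field) alg)"
proof -
  have "abs_alg 1 = abs_alg (\<Sum>i\<in>UNIV. free_gen (E i) :: ('i, 'f) free_alg)"
    unfolding alg.abs_eq_iff alg_cong_def
    by (rule two_sided_ideal.gen) (rule relators_E_sum)
  then show ?thesis
    by (simp only: agen.abs_eq one_alg.abs_eq abs_alg_sum)
qed

lemma sum_agen_Es: "(\<Sum>i\<in>UNIV. agen (Es i)) = (1 :: ('i::finite, 'f::field) alg)"
proof -
  have "abs_alg 1 = abs_alg (\<Sum>i\<in>UNIV. free_gen (Es i) :: ('i, 'f) free_alg)"
    unfolding alg.abs_eq_iff alg_cong_def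
    by (rule two_sided_ideal.gen) (rule relators_Es_sum)
  then show ?thesis
    by (simp only: agen.abs_eq one_alg.abs_eq abs_alg_sum)
qed


section \<open>The automorphism swapping starred and nonstarred generators\<close>

lemma free_swap_add: "free_swap (p + q) = free_swap p + free_swap q"
  unfolding free_swap_def by (rule lin_ext_add[OF vector_space_fscale])

lemma free_swap_diff: "free_swap (p - q) = free_swap p - free_swap q"
  unfolding free_swap_def by (rule lin_ext_diff[OF vector_space_fscale])

lemma free_swap_sum: "free_swap (sum g S) = (\<Sum>s\<in>S. free_swap (g s))"
  unfolding free_swap_def by (rule lin_ext_sum[OF vector_space_fscale])

lemma free_swap_scale: "free_swap (fscale c p) = fscale c (free_swap p)"
  unfolding free_swap_def by (rule lin_ext_scale[OF vector_space_fscale])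

lemma free_swap_mult: "free_swap (p * q) = free_swap p * free_swap q"
  unfolding free_swap_def
  by (rule lin_ext_mult[OF vector_space_fscale])
    (auto simp: fscale_mult_left fscale_mult_right mult_single plus_word_def)

lemma free_swap_zero: "free_swap 0 = 0"
  by (simp add: free_swap_def)

lemma free_swap_one: "free_swap 1 = 1"
  unfolding free_swap_def
  using lin_ext_single[OF vector_space_fscale,
      of "\<lambda>w. Poly_Mapping.single (Word (map swap_gen (letters w))) 1" 0 1]
  by (simp add: letters_zero fscale_conv_mult flip: zero_word_def)

lemma free_swap_gen: "free_swap (free_gen g) = free_gen (swap_gen g)"
  by (simp add: free_swap_def free_gen_def lin_ext_single[OF vector_space_fscale])

lemma free_swap_ideal:
  "p \<in> two_sided_ideal relators \<Longrightarrow> free_swap p \<in> two_sided_ideal relators"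
proof (induction rule: two_sided_ideal.induct)
  case (gen r)
  have if_swap: "free_swap (if b then p else 0) = (if b then free_swap p else 0)"
    for b and p :: "('a, 'b) free_alg"
    by (simp add: free_swap_zero)
  note swap = free_swap_diff free_swap_mult free_swap_gen if_swap free_swap_one free_swap_sum
    swap_gen.simps
  from gen consider (a) i j where "r = free_gen (E i) * free_gen (E j) - (if i = j then free_gen (E i) else 0)"
    | (b) i j where "r = free_gen (Es i) * free_gen (Es j) - (if i = j then free_gen (Es i) else 0)"
    | (c) "r = 1 - (\<Sum>i\<in>UNIV. free_gen (E i))"
    | (d) "r = 1 - (\<Sum>i\<in>UNIV. free_gen (Es i))"
    unfolding relators_def by auto
  then have "free_swap r \<in> relators"
  proof cases
    case a
    show ?thesis unfolding a swap by (rule relators_Es_mult)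
  next
    case b
    show ?thesis unfolding b swap by (rule relators_E_mult)
  next
    case c
    show ?thesis unfolding c swap by (rule relators_Es_sum)
  next
    case d
    show ?thesis unfolding d swap by (rule relators_E_sum)
  qed
  then show ?case by (rule two_sided_ideal.gen)
next
  case zero
  show ?case unfolding free_swap_zero by (rule two_sided_ideal.zero)
next
  case (add x y)
  then show ?case unfolding free_swap_add by (intro two_sided_ideal.add)
next
  case (lmult x a)
  then show ?case unfolding free_swap_mult by (intro two_sided_ideal.lmult)
next
  case (rmult x a)
  then show ?case unfolding free_swap_mult by (intro two_sided_ideal.rmult)
qed

lift_definition star :: "('i::finite, 'f::field) alg \<Rightarrow> ('i, 'f) alg" is free_swap
  unfolding alg_cong_def free_swap_diff[symmetric] by (rule free_swap_ideal)

lemma star_add: "star (x + y) = star x + star y"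
  by transfer (simp add: free_swap_add alg_cong_refl)

lemma star_mult: "star (x * y) = star x * star y"
  by transfer (simp add: free_swap_mult alg_cong_refl)

lemma star_scale: "star (ascale c x) = ascale c (star x)"
  by transfer (simp add: free_swap_scale alg_cong_refl)

lemma star_one: "star 1 = 1"
  by transfer (simp add: free_swap_one alg_cong_refl)

lemma star_agen: "star (agen g) = agen (swap_gen g)"
  by transfer (simp add: free_swap_gen alg_cong_refl)


section \<open>Words and the subspaces\<close>

definition is_word :: "'i gen list \<Rightarrow> bool" where
  "is_word w \<longleftrightarrow> w \<noteq> [] \<and> successively (\<lambda>g h. starred g \<noteq> starred h) w"

definition nonrepeating :: "'i gen list \<Rightarrow> bool" where
  "nonrepeating w \<longleftrightarrow> successively (\<lambda>g h. index g \<noteq> index h) w"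

definition A_sub :: "nat \<Rightarrow> ('i::finite, 'f::field) alg set" where
  "A_sub n = module.span ascale
     {prod_list (map agen w) | w. is_word w \<and> nonrepeating w \<and> length w = n \<and> \<not> starred (last w)}"

definition As_sub :: "nat \<Rightarrow> ('i::finite, 'f::field) alg set" where
  "As_sub n = star ` A_sub n"

text \<open>The sum of a family of subspaces is the span of their union.\<close>

definition F_sub :: "('i::finite, 'f::field) alg set" where
  "F_sub = module.span ascale (\<Union>n. A_sub (n + 1) \<inter> As_sub (n + 1))"


section \<open>Tensor products of subspaces\<close>

text \<open>For subspaces \<open>U\<close>, \<open>V\<close> of vector spaces with scalar multiplications \<open>sU\<close>, \<open>sV\<close>, the tensor
  product is the free vector space on \<open>U \<times> V\<close> modulo the bilinearity relations. Its elements are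
  the equivalence classes.\<close>

definition tensor_relators ::
  "('f::field \<Rightarrow> 'a \<Rightarrow> 'a) \<Rightarrow> ('f \<Rightarrow> 'b \<Rightarrow> 'b) \<Rightarrow> 'a::ab_group_add set \<Rightarrow> 'b::ab_group_add set
    \<Rightarrow> ('a \<times> 'b \<Rightarrow>\<^sub>0 'f) set" where
  "tensor_relators sU sV U V =
     {Poly_Mapping.single (u + u', v) 1 - Poly_Mapping.single (u, v) 1 - Poly_Mapping.single (u', v) 1
        | u u' v. u \<in> U \<and> u' \<in> U \<and> v \<in> V} \<union>
     {Poly_Mapping.single (u, v + v') 1 - Poly_Mapping.single (u, v) 1 - Poly_Mapping.single (u, v') 1
        | u v v'. u \<in> U \<and> v \<in> V \<and> v' \<in> V} \<union>
     {Poly_Mapping.single (sU c u, v) 1 - fscale c (Poly_Mapping.single (u, v) 1)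
        | c u v. u \<in> U \<and> v \<in> V} \<union>
     {Poly_Mapping.single (u, sV c v) 1 - fscale c (Poly_Mapping.single (u, v) 1)
        | c u v. u \<in> U \<and> v \<in> V}"

definition tensor_cong ::
  "('f::field \<Rightarrow> 'a \<Rightarrow> 'a) \<Rightarrow> ('f \<Rightarrow> 'b \<Rightarrow> 'b) \<Rightarrow> 'a::ab_group_add set \<Rightarrow> 'b::ab_group_add set
    \<Rightarrow> (('a \<times> 'b \<Rightarrow>\<^sub>0 'f) \<times> ('a \<times> 'b \<Rightarrow>\<^sub>0 'f)) set" where
  "tensor_cong sU sV U V =
     {(p, q). Poly_Mapping.keys p \<subseteq> U \<times> V \<and> Poly_Mapping.keys q \<subseteq> U \<times> V \<and>
        p - q \<in> module.span fscale (tensor_relators sU sV U V)}"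

definition tensor_space ::
  "('f::field \<Rightarrow> 'a \<Rightarrow> 'a) \<Rightarrow> ('f \<Rightarrow> 'b \<Rightarrow> 'b) \<Rightarrow> 'a::ab_group_add set \<Rightarrow> 'b::ab_group_add set
    \<Rightarrow> ('a \<times> 'b \<Rightarrow>\<^sub>0 'f) set set" where
  "tensor_space sU sV U V = {p. Poly_Mapping.keys p \<subseteq> U \<times> V} // tensor_cong sU sV U V"

definition pure_tensor ::
  "('f::field \<Rightarrow> 'a \<Rightarrow> 'a) \<Rightarrow> ('f \<Rightarrow> 'b \<Rightarrow> 'b) \<Rightarrow> 'a::ab_group_add set \<Rightarrow> 'b::ab_group_add set
    \<Rightarrow> 'a \<Rightarrow> 'b \<Rightarrow> ('a \<times> 'b \<Rightarrow>\<^sub>0 'f) set" where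
  "pure_tensor sU sV U V u v = tensor_cong sU sV U V `` {Poly_Mapping.single (u, v) 1}"

definition tensor_add ::
  "('f::field \<Rightarrow> 'a \<Rightarrow> 'a) \<Rightarrow> ('f \<Rightarrow> 'b \<Rightarrow> 'b) \<Rightarrow> 'a::ab_group_add set \<Rightarrow> 'b::ab_group_add set
    \<Rightarrow> ('a \<times> 'b \<Rightarrow>\<^sub>0 'f) set \<Rightarrow> ('a \<times> 'b \<Rightarrow>\<^sub>0 'f) set \<Rightarrow> ('a \<times> 'b \<Rightarrow>\<^sub>0 'f) set" where
  "tensor_add sU sV U V X Y = (\<Union>p\<in>X. \<Union>q\<in>Y. tensor_cong sU sV U V `` {p + q})"

definition tensor_scale ::
  "('f::field \<Rightarrow> 'a \<Rightarrow> 'a) \<Rightarrow> ('f \<Rightarrow> 'b \<Rightarrow> 'b) \<Rightarrow> 'a::ab_group_add set \<Rightarrow> 'b::ab_group_add set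
    \<Rightarrow> 'f \<Rightarrow> ('a \<times> 'b \<Rightarrow>\<^sub>0 'f) set \<Rightarrow> ('a \<times> 'b \<Rightarrow>\<^sub>0 'f) set" where
  "tensor_scale sU sV U V c X = (\<Union>p\<in>X. tensor_cong sU sV U V `` {fscale c p})"

definition tensor_linear ::
  "('f::field \<Rightarrow> 'a \<Rightarrow> 'a) \<Rightarrow> ('f \<Rightarrow> 'b \<Rightarrow> 'b) \<Rightarrow> ('f \<Rightarrow> 'c \<Rightarrow> 'c)
    \<Rightarrow> 'a::ab_group_add set \<Rightarrow> 'b::ab_group_add set
    \<Rightarrow> (('a \<times> 'b \<Rightarrow>\<^sub>0 'f) set \<Rightarrow> 'c::ab_group_add) \<Rightarrow> bool" where
  "tensor_linear sU sV sW U V \<phi> \<longleftrightarrow>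
     (\<forall>X\<in>tensor_space sU sV U V. \<forall>Y\<in>tensor_space sU sV U V.
        \<phi> (tensor_add sU sV U V X Y) = \<phi> X + \<phi> Y) \<and>
     (\<forall>c. \<forall>X\<in>tensor_space sU sV U V. \<phi> (tensor_scale sU sV U V c X) = sW c (\<phi> X))"

lemma equiv_tensor_cong:
  "equiv {p. Poly_Mapping.keys p \<subseteq> U \<times> V} (tensor_cong sU sV U V)"
proof -
  interpret vector_space fscale by (rule vector_space_fscale)
  show ?thesis
  proof (rule equivI)
    show "refl_on {p. Poly_Mapping.keys p \<subseteq> U \<times> V} (tensor_cong sU sV U V)"
      by (auto simp: refl_on_def tensor_cong_def span_zero)
    show "sym (tensor_cong sU sV U V)"
    proof (rule symI)
      fix p q assume "(p, q) \<in> tensor_cong sU sV U V"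
      then show "(q, p) \<in> tensor_cong sU sV U V"
        using span_neg[of "p - q"] by (auto simp: tensor_cong_def)
    qed
    show "trans (tensor_cong sU sV U V)"
    proof (rule transI)
      fix p q r assume "(p, q) \<in> tensor_cong sU sV U V" "(q, r) \<in> tensor_cong sU sV U V"
      then show "(p, r) \<in> tensor_cong sU sV U V"
        using span_add[of "p - q" _ "q - r"] by (auto simp: tensor_cong_def)
    qed
  qed (auto simp: tensor_cong_def)
qed

lemma tensor_add_class:
  assumes "Poly_Mapping.keys p \<subseteq> U \<times> V" "Poly_Mapping.keys q \<subseteq> U \<times> V"
  shows "tensor_add sU sV U V (tensor_cong sU sV U V `` {p}) (tensor_cong sU sV U V `` {q})
    = tensor_cong sU sV U V `` {p + q}"
proof -
  interpret vector_space fscale by (rule vector_space_fscale)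
  have "congruent2 (tensor_cong sU sV U V) (tensor_cong sU sV U V)
      (\<lambda>p q. tensor_cong sU sV U V `` {p + q})"
  proof (rule congruent2I')
    fix p p' q q'
    assume "(p, p') \<in> tensor_cong sU sV U V" "(q, q') \<in> tensor_cong sU sV U V"
    then have "(p + q, p' + q') \<in> tensor_cong sU sV U V"
      using keys_add[of p q] keys_add[of p' q']
      by (auto simp: tensor_cong_def add_diff_add intro: span_add)
    then show "tensor_cong sU sV U V `` {p + q} = tensor_cong sU sV U V `` {p' + q'}"
      by (rule equiv_class_eq[OF equiv_tensor_cong])
  qed
  then show ?thesis
    unfolding tensor_add_def
    using UN_equiv_class2[OF equiv_tensor_cong equiv_tensor_cong] assms by blast
qed

lemma tensor_scale_class:
  assumes "Poly_Mapping.keys p \<subseteq> U \<times> V"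
  shows "tensor_scale sU sV U V c (tensor_cong sU sV U V `` {p})
    = tensor_cong sU sV U V `` {fscale c p}"
proof -
  interpret vector_space fscale by (rule vector_space_fscale)
  have "congruent (tensor_cong sU sV U V) (\<lambda>p. tensor_cong sU sV U V `` {fscale c p})"
  proof (rule congruentI)
    fix p p'
    assume "(p, p') \<in> tensor_cong sU sV U V"
    then have "(fscale c p, fscale c p') \<in> tensor_cong sU sV U V"
      by (auto simp: tensor_cong_def in_keys_iff subset_iff simp flip: scale_right_diff_distrib
          intro: span_scale)
    then show "tensor_cong sU sV U V `` {fscale c p} = tensor_cong sU sV U V `` {fscale c p'}"
      by (rule equiv_class_eq[OF equiv_tensor_cong])
  qed
  then show ?thesis
    unfolding tensor_scale_def
    using UN_equiv_class[OF equiv_tensor_cong] assms by blast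
qed

text \<open>A linear map on the tensor product is determined by its values on pure tensors.\<close>

lemma tensor_linear_unique:
  assumes \<phi>: "tensor_linear sU sV sW U V \<phi>" and \<psi>: "tensor_linear sU sV sW U V \<psi>"
    and W: "vector_space sW"
    and eq: "\<And>u v. u \<in> U \<Longrightarrow> v \<in> V \<Longrightarrow>
      \<phi> (pure_tensor sU sV U V u v) = \<psi> (pure_tensor sU sV U V u v)"
    and X: "X \<in> tensor_space sU sV U V"
  shows "\<phi> X = \<psi> X"
proof -
  let ?T = "\<lambda>p. tensor_cong sU sV U V `` {p}"
  interpret W: vector_space sW by fact
  have T: "?T p \<in> tensor_space sU sV U V" if "Poly_Mapping.keys p \<subseteq> U \<times> V" for p
    using that by (simp add: tensor_space_def quotientI)
  have zero: "\<chi> (?T 0) = 0" if "tensor_linear sU sV sW U V \<chi>" for \<chi>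
  proof -
    have "tensor_scale sU sV U V 0 (?T 0) = ?T 0"
      using tensor_scale_class[of 0 U V sU sV 0] by simp
    then show ?thesis
      using that T[of 0] unfolding tensor_linear_def
      by (metis W.scale_zero_left empty_subsetI keys_zero)
  qed
  have "\<phi> (?T p) = \<psi> (?T p)" if "Poly_Mapping.keys p \<subseteq> U \<times> V" for p
    using that
  proof (induction p rule: update_induct)
    case const
    show ?case using zero[OF \<phi>] zero[OF \<psi>] by simp
  next
    case (update p a c)
    have upd: "Poly_Mapping.update a c p = p + fscale c (Poly_Mapping.single a 1)"
      using update by (auto intro!: poly_mapping_eqI
          simp: lookup_update lookup_add lookup_single when_def in_keys_iff)
    have p: "Poly_Mapping.keys p \<subseteq> U \<times> V" and a: "a \<in> U \<times> V"
      using update by (auto simp: keys_update split: if_splits)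
    have s: "Poly_Mapping.keys (Poly_Mapping.single a (1::'a)) \<subseteq> U \<times> V"
      and cs: "Poly_Mapping.keys (fscale c (Poly_Mapping.single a (1::'a))) \<subseteq> U \<times> V"
      using a by auto
    have step: "\<chi> (?T (Poly_Mapping.update a c p))
        = \<chi> (?T p) + sW c (\<chi> (pure_tensor sU sV U V (fst a) (snd a)))"
      if \<chi>: "tensor_linear sU sV sW U V \<chi>" for \<chi>
      using \<chi> T[OF p] T[OF s] T[OF cs]
      unfolding tensor_linear_def upd pure_tensor_def
      by (simp add: tensor_add_class[OF p cs, symmetric] tensor_scale_class[OF s, symmetric]
          del: fscale_single)
    show ?case
      using a eq[of "fst a" "snd a"] update.IH[OF p] by (auto simp: step[OF \<phi>] step[OF \<psi>])
  qed
  then show ?thesis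
    using X by (auto simp: tensor_space_def quotient_def)
qed

end

(* Put s_i = e_i - e*_i. A nonrepeating word g_1 ... g_{n+1} with indices i_1, ..., i_{n+1} equals
   +- s_{i_1} ... s_{i_n} g_{n+1}, and left multiplication by s_i maps A_n into A_{n+1} and A*_n into
   A*_{n+1}; hence the n-fold products of the s_i span a subspace S_n of A_{n+1} \<inter> A*_{n+1}, and
   A_{n+1} = sum_j S_n e_j. The sum S of the S_n satisfies S A_1 = A because
   e_j e*_k = (s_j + delta_jk) (e_k - s_k) makes S A_1 a right ideal containing 1.
   Read as rewriting rules, the same identities define a right action of A on row vectors (indexed by
   0, ..., d) over the free algebra on the s_i. Acting on (1, ..., 1), it sends u e_j with u in S to
   u times the j-th unit vector, so A is a free left S-module on the e_j, and likewise on the e*_j.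
   Finally, if x = sum_j y_j e_j = sum_j z_j e*_j with y_j, z_j in S_n, then comparing coordinates gives
   y_j - z_j = - sum_k z_k s_k. The degrees n and n + 1 differ, so sum_k z_k s_k = 0; as
   sum_k s_k = 0 generates the left linear relations among the s_k over the free algebra, all z_k coincide and x = z_0 lies in S_n.
   Thus F = S. *)

theory Submission
  imports Defs
begin

interpretation fs: vector_space fscale
  by (rule vector_space_fscale)

interpretation alg: vector_space ascale
  by (rule vector_space_ascale)

section \<open>Additive induction over finitely supported functions\<close>

lemma poly_mapping_sum_single:
  "(\<Sum>x\<in>Poly_Mapping.keys p. Poly_Mapping.single x (Poly_Mapping.lookup p x)) = p"
  by (rule poly_mapping_eqI) (simp add: lookup_sum lookup_single when_def in_keys_iff)

lemma poly_mapping_single_induct [consumes 1, case_names zero single add]: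
  fixes p :: "'x \<Rightarrow>\<^sub>0 'f::field"
  assumes "Poly_Mapping.keys p \<subseteq> S"
    and "P 0" "\<And>x c. x \<in> S \<Longrightarrow> P (Poly_Mapping.single x c)" "\<And>p q. P p \<Longrightarrow> P q \<Longrightarrow> P (p + q)"
  shows "P p"
proof -
  have "P (\<Sum>x\<in>K. Poly_Mapping.single x (Poly_Mapping.lookup p x))" if "K \<subseteq> Poly_Mapping.keys p" for K
    using finite_subset[OF that finite_keys] that assms(1)
    by (induction K rule: finite_induct) (auto intro: assms(2-))
  from this[of "Poly_Mapping.keys p"] show ?thesis
    by (simp add: poly_mapping_sum_single)
qed

lemmas poly_mapping_single_induct_UNIV [case_names zero single add] =
  poly_mapping_single_induct[OF subset_UNIV]

subsection \<open>Tensor products with a finite-dimensional space\<close>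

context
  fixes sU :: "'f::field \<Rightarrow> 'a::ab_group_add \<Rightarrow> 'a"
    and sV :: "'f \<Rightarrow> 'b::ab_group_add \<Rightarrow> 'b"
    and sW :: "'f \<Rightarrow> 'c::ab_group_add \<Rightarrow> 'c"
    and U :: "'a set" and V :: "'b set"
    and f :: "'a \<Rightarrow> 'b \<Rightarrow> 'c"
    and v :: "'i::finite \<Rightarrow> 'b"
  assumes vsU: "vector_space sU" and vsV: "vector_space sV" and vsW: "vector_space sW"
    and U: "module.subspace sU U" and V: "V = module.span sV (range v)"
    and add_l: "\<And>x y z. f (x + y) z = f x z + f y z"
    and add_r: "\<And>x y z. f x (y + z) = f x y + f x z"
    and scale_l: "\<And>c x y. f (sU c x) y = sW c (f x y)"
    and scale_r: "\<And>c x y. f x (sV c y) = sW c (f x y)"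
begin

interpretation U: vector_space sU by (rule vsU)
interpretation V: vector_space sV by (rule vsV)
interpretation W: vector_space sW by (rule vsW)

private abbreviation "rels \<equiv> fs.span (tensor_relators sU sV U V)"
private abbreviation "L \<equiv> lin_ext sW (\<lambda>(x, y). f x y)"

private lemma V_subspace: "V.subspace V"
  unfolding V by (rule V.subspace_span)

private lemma range_v: "v j \<in> V"
  unfolding V by (rule V.span_base) simp

text \<open>Bilinearity of \<open>f\<close> kills each relator, so the linear extension
  \<open>L\<close> descends to the tensor product.\<close>

private lemma L_rels: "r \<in> rels \<Longrightarrow> L r = 0"
proof (induction rule: fs.span_induct_alt)
  case base
  show ?case by simp
next
  case (step c r q)
  from step(1) have "L r = 0"
    unfolding tensor_relators_def
    by (auto simp: lin_ext_diff[OF vsW] lin_ext_single[OF vsW] add_l add_r scale_l scale_r)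
  then show ?case
    using step by (simp add: lin_ext_add[OF vsW] lin_ext_scale[OF vsW])
qed

private lemma rel_add_l:
  "x \<in> U \<Longrightarrow> x' \<in> U \<Longrightarrow> y \<in> V \<Longrightarrow> Poly_Mapping.single (x + x', y) 1
    - Poly_Mapping.single (x, y) 1 - Poly_Mapping.single (x', y) 1 \<in> rels"
  by (rule fs.span_base) (auto simp: tensor_relators_def)

private lemma rel_add_r:
  "x \<in> U \<Longrightarrow> y \<in> V \<Longrightarrow> y' \<in> V \<Longrightarrow> Poly_Mapping.single (x, y + y') 1
    - Poly_Mapping.single (x, y) 1 - Poly_Mapping.single (x, y') 1 \<in> rels"
  by (rule fs.span_base) (auto simp: tensor_relators_def)

private lemma rel_scale_l:
  "x \<in> U \<Longrightarrow> y \<in> V \<Longrightarrow> Poly_Mapping.single (sU c x, y) 1 - Poly_Mapping.single (x, y) c \<in> rels"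
  by (rule fs.span_base) (unfold tensor_relators_def, auto)

private lemma rel_scale_r:
  "x \<in> U \<Longrightarrow> y \<in> V \<Longrightarrow> Poly_Mapping.single (x, sV c y) 1 - Poly_Mapping.single (x, y) c \<in> rels"
  by (rule fs.span_base) (unfold tensor_relators_def, auto)

private lemma rel_zero_l: "y \<in> V \<Longrightarrow> Poly_Mapping.single (0, y) 1 \<in> rels"
  using rel_scale_l[of 0 y 0] U.subspace_0[OF U] by simp

private lemma rel_zero_r: "x \<in> U \<Longrightarrow> Poly_Mapping.single (x, 0) 1 \<in> rels"
  using rel_scale_r[of x 0 0] V.subspace_0[OF V_subspace] by simp

text \<open>The normal form sum of \<open>u j\<close> tensor \<open>v j\<close>, with one vector of
  \<open>U\<close> per member of the spanning family; scalars are absorbed into the left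
  factor.\<close>

private definition reducible :: "('a \<times> 'b \<Rightarrow>\<^sub>0 'f) \<Rightarrow> bool" where
  "reducible p \<longleftrightarrow> (\<exists>u. range u \<subseteq> U \<and> p - (\<Sum>j\<in>UNIV. Poly_Mapping.single (u j, v j) 1) \<in> rels)"

private lemma reducible_cong: "reducible q \<Longrightarrow> p - q \<in> rels \<Longrightarrow> reducible p"
  unfolding reducible_def by (metis (no_types, lifting) diff_add_cancel add_diff_eq fs.span_add)

private lemma reducible_zero: "reducible 0"
  unfolding reducible_def
proof (intro exI[of _ "\<lambda>_. 0"] conjI)
  show "0 - (\<Sum>j\<in>UNIV. Poly_Mapping.single (0, v j) 1) \<in> rels"
    by (intro fs.span_diff fs.span_sum fs.span_zero rel_zero_l range_v)
qed (use U.subspace_0[OF U] in auto)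

private lemma reducible_add:
  assumes "reducible p" "reducible q"
  shows "reducible (p + q)"
proof -
  let ?m = "\<lambda>u. \<Sum>j\<in>UNIV. Poly_Mapping.single (u j, v j) (1::'f)"
  obtain a where a: "range a \<subseteq> U" "p - ?m a \<in> rels"
    using assms(1) unfolding reducible_def by blast
  obtain b where b: "range b \<subseteq> U" "q - ?m b \<in> rels"
    using assms(2) unfolding reducible_def by blast
  have "(\<Sum>j\<in>UNIV. Poly_Mapping.single (a j + b j, v j) (1::'f)
      - Poly_Mapping.single (a j, v j) 1 - Poly_Mapping.single (b j, v j) 1) \<in> rels"
    using a b by (intro fs.span_sum rel_add_l range_v) auto
  then have *: "?m (\<lambda>j. a j + b j) - ?m a - ?m b \<in> rels"
    by (simp add: sum_subtractf)
  have "p + q - ?m (\<lambda>j. a j + b j) = (p - ?m a) + (q - ?m b) - (?m (\<lambda>j. a j + b j) - ?m a - ?m b)"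
    by simp
  also have "\<dots> \<in> rels"
    by (rule fs.span_diff[OF fs.span_add[OF a(2) b(2)] *])
  finally show ?thesis
    unfolding reducible_def using a(1) b(1)
    by (intro exI[of _ "\<lambda>j. a j + b j"]) (auto intro!: U.subspace_add[OF U])
qed

text \<open>The scalar moves into the left factor, and the other coordinates are 0. The formal basis
  vectors at \<open>(0, v j)\<close> are not themselves 0; they only lie in
  \<open>rels\<close>.\<close>

private lemma reducible_basis:
  assumes x: "x \<in> U"
  shows "reducible (Poly_Mapping.single (x, v k) c)"
proof -
  let ?u = "\<lambda>j. if j = k then sU c x else 0"
  have "(\<Sum>j\<in>UNIV. Poly_Mapping.single (?u j, v j) (1::'f))
      = (\<Sum>j\<in>UNIV. (if j = k then Poly_Mapping.single (sU c x, v k) 1 else 0)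
          + (if j = k then 0 else Poly_Mapping.single (0, v j) 1))"
    by (rule sum.cong) auto
  also have "\<dots> = Poly_Mapping.single (sU c x, v k) 1
      + (\<Sum>j\<in>UNIV. if j = k then 0 else Poly_Mapping.single (0, v j) 1)"
    by (simp add: sum.distrib)
  finally have eq: "Poly_Mapping.single (x, v k) c - (\<Sum>j\<in>UNIV. Poly_Mapping.single (?u j, v j) (1::'f))
      = - (Poly_Mapping.single (sU c x, v k) 1 - Poly_Mapping.single (x, v k) c)
        - (\<Sum>j\<in>UNIV. if j = k then 0 else Poly_Mapping.single (0, v j) 1)"
    by simp
  have "\<dots> \<in> rels"
    by (intro fs.span_diff fs.span_neg rel_scale_l fs.span_sum x range_v)
      (auto intro: fs.span_zero rel_zero_l range_v)
  then show ?thesis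
    unfolding reducible_def eq[symmetric]
    using x by (intro exI[of _ ?u]) (auto intro: U.subspace_scale[OF U] U.subspace_0[OF U])
qed

private lemma reducible_single:
  assumes x: "x \<in> U" and y: "y \<in> V"
  shows "reducible (Poly_Mapping.single (x, y) c)"
proof -
  \<comment> \<open>Membership in \<open>V\<close> is carried along because the additivity relators
    require it. The claim ranges over all left factors since the coefficient \<open>c\<close> is
    finally absorbed by passing to \<open>sU c x\<close>.\<close>
  have "y \<in> V \<and> (\<forall>x\<in>U. reducible (Poly_Mapping.single (x, y) 1))"
    using y[unfolded V]
  proof (induction rule: V.span_induct_alt)
    case base
    show ?case
      using reducible_cong[OF reducible_zero] rel_zero_r V.subspace_0[OF V_subspace] by simp
  next
    case (step c z y)
    then obtain k where z: "z = v k" by blast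
    have zV: "z \<in> V" and yV: "y \<in> V"
      using step range_v z by auto
    have cz: "sV c z \<in> V" by (rule V.subspace_scale[OF V_subspace zV])
    have "reducible (Poly_Mapping.single (x, sV c z + y) 1)" if "x \<in> U" for x
    proof (rule reducible_cong)
      show "reducible (Poly_Mapping.single (x, z) c + Poly_Mapping.single (x, y) 1)"
        using step that reducible_basis[of x k c] z by (auto intro: reducible_add)
      have "Poly_Mapping.single (x, sV c z + y) 1
          - (Poly_Mapping.single (x, z) c + Poly_Mapping.single (x, y) 1)
        = (Poly_Mapping.single (x, sV c z + y) 1 - Poly_Mapping.single (x, sV c z) 1
            - Poly_Mapping.single (x, y) 1)
          + (Poly_Mapping.single (x, sV c z) 1 - Poly_Mapping.single (x, z) c)"
        by simp
      also have "\<dots> \<in> rels"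
        by (intro fs.span_add rel_add_r rel_scale_r that cz zV yV)
      finally show "Poly_Mapping.single (x, sV c z + y) 1
          - (Poly_Mapping.single (x, z) c + Poly_Mapping.single (x, y) 1) \<in> rels" .
    qed
    then show ?case
      using V.subspace_add[OF V_subspace cz yV] by blast
  qed
  then have "reducible (Poly_Mapping.single (sU c x, y) 1)"
    using U.subspace_scale[OF U x] by blast
  moreover have "Poly_Mapping.single (x, y) c - Poly_Mapping.single (sU c x, y) 1 \<in> rels"
    using fs.span_neg[OF rel_scale_l[OF x y, of c]] by simp
  ultimately show ?thesis
    by (rule reducible_cong)
qed

private lemma reducible: "Poly_Mapping.keys p \<subseteq> U \<times> V \<Longrightarrow> reducible p"
  by (induction p rule: poly_mapping_single_induct)
    (auto intro: reducible_zero reducible_add reducible_single)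

text \<open>Existence of expansions gives surjectivity. For injectivity, a kernel element is brought
  to normal form; uniqueness of expansions then makes its coordinates 0.\<close>

lemma tensor_iso_of_unique_expansion:
  assumes surj: "\<And>w. \<exists>u. range u \<subseteq> U \<and> w = (\<Sum>j\<in>UNIV. f (u j) (v j))"
    and inj: "\<And>u. range u \<subseteq> U \<Longrightarrow> (\<Sum>j\<in>UNIV. f (u j) (v j)) = 0 \<Longrightarrow> u = (\<lambda>_. 0)"
  shows "\<exists>\<phi>. tensor_linear sU sV sW U V \<phi> \<and>
      (\<forall>x\<in>U. \<forall>y\<in>V. \<phi> (pure_tensor sU sV U V x y) = f x y) \<and>
      bij_betw \<phi> (tensor_space sU sV U V) UNIV"
proof -
  let ?K = "{p. Poly_Mapping.keys p \<subseteq> U \<times> V}"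
  let ?T = "\<lambda>p. tensor_cong sU sV U V `` {p}"
  \<comment> \<open>The choice of representative does not matter, because \<open>L\<close> vanishes
    on \<open>rels\<close>; this is \<open>\<phi>_class\<close>.\<close>
  define \<phi> where "\<phi> X = L (SOME p. p \<in> X)" for X :: "('a \<times> 'b \<Rightarrow>\<^sub>0 'f) set"
  have L_inj: "p \<in> rels" if p: "p \<in> ?K" and "L p = 0" for p
  proof -
    obtain u where u: "range u \<subseteq> U"
      and r: "p - (\<Sum>j\<in>UNIV. Poly_Mapping.single (u j, v j) 1) \<in> rels"
      using reducible p unfolding reducible_def by blast
    have "(\<Sum>j\<in>UNIV. f (u j) (v j)) = 0"
      using L_rels[OF r] \<open>L p = 0\<close>
      by (simp add: lin_ext_diff[OF vsW] lin_ext_sum[OF vsW] lin_ext_single[OF vsW])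
    then have "u = (\<lambda>_. 0)" by (rule inj[OF u])
    then have "(\<Sum>j\<in>UNIV. Poly_Mapping.single (u j, v j) 1) \<in> rels"
      by (auto intro!: fs.span_sum rel_zero_l range_v)
    from fs.span_add[OF r this] show ?thesis by simp
  qed
  have \<phi>_class: "\<phi> (?T p) = L p" if "p \<in> ?K" for p
  proof -
    have "p \<in> ?T p"
      by (rule equiv_class_self[OF equiv_tensor_cong that])
    define q where "q = (SOME q. q \<in> ?T p)"
    have "q \<in> ?T p"
      unfolding q_def by (rule someI) fact
    then have "p - q \<in> rels"
      by (simp add: tensor_cong_def)
    from L_rels[OF this] have "L p = L q"
      by (simp add: lin_ext_diff[OF vsW])
    then show ?thesis
      unfolding \<phi>_def q_def by (rule sym)
  qed
  have keys_add': "p + q \<in> ?K" if "p \<in> ?K" "q \<in> ?K" for p q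
    using that keys_add[of p q] by auto
  have keys_scale: "fscale c p \<in> ?K" if "p \<in> ?K" for c p
    using that by (auto simp: in_keys_iff subset_iff)
  have "tensor_linear sU sV sW U V \<phi>"
    unfolding tensor_linear_def tensor_space_def
  proof (intro conjI ballI allI)
    fix X Y assume "X \<in> ?K // tensor_cong sU sV U V" "Y \<in> ?K // tensor_cong sU sV U V"
    then obtain p q where "X = ?T p" "Y = ?T q" "p \<in> ?K" "q \<in> ?K"
      by (metis quotientE)
    then show "\<phi> (tensor_add sU sV U V X Y) = \<phi> X + \<phi> Y"
      using keys_add'[of p q] by (simp add: tensor_add_class \<phi>_class lin_ext_add[OF vsW])
  next
    fix c X assume "X \<in> ?K // tensor_cong sU sV U V"
    then obtain p where "X = ?T p" "p \<in> ?K"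
      by (metis quotientE)
    then show "\<phi> (tensor_scale sU sV U V c X) = sW c (\<phi> X)"
      using keys_scale[of p c] by (simp add: tensor_scale_class \<phi>_class lin_ext_scale[OF vsW])
  qed
  moreover have "\<phi> (pure_tensor sU sV U V x y) = f x y" if "x \<in> U" "y \<in> V" for x y
    using that by (simp add: pure_tensor_def \<phi>_class lin_ext_single[OF vsW])
  moreover have "bij_betw \<phi> (tensor_space sU sV U V) UNIV"
    unfolding bij_betw_def
  proof
    show "inj_on \<phi> (tensor_space sU sV U V)"
    proof (rule inj_onI)
      fix X Y assume "X \<in> tensor_space sU sV U V" "Y \<in> tensor_space sU sV U V" and eq: "\<phi> X = \<phi> Y"
      then obtain p q where pq: "X = ?T p" "Y = ?T q" "p \<in> ?K" "q \<in> ?K"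
        unfolding tensor_space_def by (metis quotientE)
      have "p - q \<in> ?K"
        using keys_add'[OF pq(3) keys_scale[OF pq(4), of "- 1"]] by simp
      moreover have "L (p - q) = 0"
        using eq pq by (simp add: \<phi>_class lin_ext_diff[OF vsW])
      ultimately have "p - q \<in> rels"
        by (rule L_inj)
      then have "(p, q) \<in> tensor_cong sU sV U V"
        using pq by (simp add: tensor_cong_def)
      then show "X = Y"
        unfolding pq by (rule equiv_class_eq[OF equiv_tensor_cong])
    qed
    have "w \<in> \<phi> ` tensor_space sU sV U V" for w
    proof -
      obtain u where u: "range u \<subseteq> U" "w = (\<Sum>j\<in>UNIV. f (u j) (v j))"
        using surj by blast
      let ?p = "\<Sum>j\<in>UNIV. Poly_Mapping.single (u j, v j) (1::'f)"
      have "Poly_Mapping.keys ?p \<subseteq> (\<Union>j. Poly_Mapping.keys (Poly_Mapping.single (u j, v j) (1::'f)))"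
        by (rule keys_sum)
      also have "\<dots> \<subseteq> U \<times> V"
        using u(1) range_v by auto
      finally have p: "?p \<in> ?K" by simp
      then have "\<phi> (?T ?p) = w"
        by (simp add: \<phi>_class lin_ext_sum[OF vsW] lin_ext_single[OF vsW] u(2))
      moreover have "?T ?p \<in> tensor_space sU sV U V"
        unfolding tensor_space_def by (rule quotientI) (rule p)
      ultimately show ?thesis by blast
    qed
    then show "\<phi> ` tensor_space sU sV U V = UNIV" by blast
  qed
  ultimately show ?thesis by blast
qed

end


subsection \<open>The free algebra and the right action of A on row vectors\<close>

type_synonym ('i, 'f) fralg = "'i word \<Rightarrow>\<^sub>0 'f"

definition var :: "'i \<Rightarrow> ('i, 'f::field) fralg" where
  "var i = Poly_Mapping.single (Word [i]) 1"

text \<open>The \<open>s\<^sub>i\<close> sum to 0, so one of them, at the arbitrary index \<open>undefined\<close>, is eliminated; the variable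
  \<open>var undefined\<close> of the free algebra is idle.\<close>

definition svar :: "'i::finite \<Rightarrow> ('i, 'f::field) fralg" where
  "svar i = (if i = undefined then - (\<Sum>j\<in>UNIV - {undefined}. var j) else var i)"

lemma sum_svar: "(\<Sum>i\<in>UNIV. svar i) = (0 :: ('i::finite, 'f::field) fralg)"
proof -
  have "(\<Sum>i\<in>UNIV. svar i) = svar undefined + (\<Sum>i\<in>UNIV - {undefined}. svar i :: ('i, 'f) fralg)"
    by (rule sum.remove) auto
  also have "(\<Sum>i\<in>UNIV - {undefined}. svar i) = (\<Sum>i\<in>UNIV - {undefined}. var i :: ('i, 'f) fralg)"
    by (rule sum.cong) (auto simp: svar_def)
  finally show ?thesis by (simp add: svar_def)
qed

section \<open>Homogeneous elements and left linear relations in the free algebra\<close>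

definition homogeneous :: "nat \<Rightarrow> ('i, 'f::field) fralg \<Rightarrow> bool" where
  "homogeneous n p \<longleftrightarrow> (\<forall>w\<in>Poly_Mapping.keys p. length (letters w) = n)"

lemma homogeneous_zero: "homogeneous n 0"
  by (simp add: homogeneous_def)

lemma homogeneous_add: "homogeneous n p \<Longrightarrow> homogeneous n q \<Longrightarrow> homogeneous n (p + q)"
  using keys_add[of p q] by (auto simp: homogeneous_def)

lemma homogeneous_uminus: "homogeneous n p \<Longrightarrow> homogeneous n (- p)"
  by (simp add: homogeneous_def)

lemma homogeneous_diff: "homogeneous n p \<Longrightarrow> homogeneous n q \<Longrightarrow> homogeneous n (p - q)"
  using homogeneous_add[of n p "- q"] homogeneous_uminus[of n q] by simp

lemma homogeneous_sum: "(\<And>x. x \<in> S \<Longrightarrow> homogeneous n (f x)) \<Longrightarrow> homogeneous n (sum f S)"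
  by (induction S rule: infinite_finite_induct) (auto intro: homogeneous_zero homogeneous_add)

lemma homogeneous_fscale: "homogeneous n p \<Longrightarrow> homogeneous n (fscale c p)"
  by (auto simp: homogeneous_def in_keys_iff)

lemma homogeneous_mult: "homogeneous m p \<Longrightarrow> homogeneous n q \<Longrightarrow> homogeneous (m + n) (p * q)"
  using keys_mult[of p q] by (fastforce simp: homogeneous_def plus_word_def)

lemma homogeneous_one: "homogeneous 0 1"
  by (simp add: homogeneous_def letters_zero)

lemma homogeneous_svar: "homogeneous 1 (svar i :: ('i::finite, 'f::field) fralg)"
proof -
  have "homogeneous 1 (var j :: ('i, 'f) fralg)" for j
    by (simp add: homogeneous_def var_def)
  then show ?thesis
    by (auto simp: svar_def intro: homogeneous_uminus homogeneous_sum)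
qed

lemma homogeneous_unique: "homogeneous m p \<Longrightarrow> homogeneous n p \<Longrightarrow> m \<noteq> n \<Longrightarrow> p = 0"
  by (metis homogeneous_def ex_in_conv keys_eq_empty)

lemma homogeneous_prod_svar: "homogeneous (length w) (prod_list (map svar w))"
  using homogeneous_mult[OF homogeneous_svar]
  by (induction w) (auto intro: homogeneous_one)

text \<open>Right multiplication by a variable appends a letter, so products ending in different
  variables share no words and cannot cancel.\<close>

lemma lookup_mult_var:
  "Poly_Mapping.lookup (p * var l) (Word (w @ [k])) = (if l = k then Poly_Mapping.lookup p (Word w) else 0)"
proof (induction p rule: poly_mapping_single_induct_UNIV)
  case (single x c)
  show ?case
    by (cases x) (auto simp: var_def mult_single lookup_single when_def plus_word_def)
qed (simp_all add: lookup_add distrib_right)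

text \<open>Substituting for the eliminated \<open>svar undefined\<close> leaves a relation among
  genuine variables with coefficients \<open>q k - q undefined\<close>. Comparing words that end in
  \<open>k\<close> shows that each of these is 0.\<close>

lemma svar_relation:
  fixes q :: "'i::finite \<Rightarrow> ('i, 'f::field) fralg"
  assumes "(\<Sum>k\<in>UNIV. q k * svar k) = 0"
  shows "q k = q l"
proof -
  let ?o = "undefined :: 'i"
  have *: "(\<Sum>k\<in>UNIV - {?o}. (q k - q ?o) * var k) = 0"
  proof -
    have "(\<Sum>k\<in>UNIV. q k * svar k) = q ?o * svar ?o + (\<Sum>k\<in>UNIV - {?o}. q k * svar k)"
      by (rule sum.remove) auto
    also have "(\<Sum>k\<in>UNIV - {?o}. q k * svar k) = (\<Sum>k\<in>UNIV - {?o}. q k * var k)"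
      by (rule sum.cong) (auto simp: svar_def)
    finally show ?thesis
      using assms by (simp add: svar_def left_diff_distrib sum_subtractf sum_distrib_left)
  qed
  have "q k = q ?o" for k
  proof (cases "k = ?o")
    case False
    show ?thesis
    proof (rule poly_mapping_eqI)
      fix x :: "'i word"
      obtain w where x: "x = Word w" by (cases x)
      have "0 = Poly_Mapping.lookup (\<Sum>k\<in>UNIV - {?o}. (q k - q ?o) * var k) (Word (w @ [k]))"
        unfolding * by simp
      also have "\<dots> = Poly_Mapping.lookup (q k - q ?o) (Word w)"
        using False by (simp add: lookup_sum lookup_mult_var)
      finally show "Poly_Mapping.lookup (q k) x = Poly_Mapping.lookup (q ?o) x"
        by (simp add: lookup_minus x)
    qed
  qed simp
  from this[of k] this[of l] show ?thesis by simp
qed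

text \<open>The formula for \<open>Es k\<close> is \<open>e\<^sub>j e\<^sup>*\<^sub>k = (s\<^sub>j + \<delta>\<^sub>j\<^sub>k) (e\<^sub>k - s\<^sub>k)\<close>, with \<open>s\<^sub>k\<close> on the right read
  as \<open>s\<^sub>k (\<Sum>l. e\<^sub>l)\<close>.\<close>

definition star_coeff :: "('i::finite \<Rightarrow> ('i, 'f::field) fralg) \<Rightarrow> 'i \<Rightarrow> ('i, 'f) fralg" where
  "star_coeff m k = m k + (\<Sum>j\<in>UNIV. m j * svar j)"

text \<open>A row \<open>m\<close> stands for the sum of the \<open>m j\<close> times
  \<open>e\<^sub>j\<close>, and \<open>step g\<close> models right multiplication by the generator
  \<open>g\<close>.\<close>

primrec step :: "'i gen \<Rightarrow> ('i::finite \<Rightarrow> ('i, 'f::field) fralg) \<Rightarrow> 'i \<Rightarrow> ('i, 'f) fralg" where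
  "step (E k) m = (\<lambda>l. if l = k then m k else 0)"
| "step (Es k) m = (\<lambda>l. star_coeff m k * ((if l = k then 1 else 0) - svar k))"

lemma step_add: "step g (\<lambda>j. m j + m' j) = (\<lambda>j. step g m j + step g m' j)"
  by (cases g) (auto simp: star_coeff_def algebra_simps sum.distrib)

lemma step_fscale: "step g (\<lambda>j. fscale c (m j)) = (\<lambda>j. fscale c (step g m j))"
  by (cases g) (auto simp: star_coeff_def fscale_mult_left fscale_mult_right fs.scale_sum_right fs.scale_right_distrib
      fs.scale_right_diff_distrib algebra_simps simp flip: fs.scale_sum_right)

lemma fold_step_add: "fold step w (\<lambda>j. m j + m' j) = (\<lambda>j. fold step w m j + fold step w m' j)"
  by (induction w arbitrary: m m') (simp_all add: step_add)

lemma fold_step_fscale: "fold step w (\<lambda>j. fscale c (m j)) = (\<lambda>j. fscale c (fold step w m j))"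
  by (induction w arbitrary: m) (simp_all add: step_fscale)

text \<open>The orthogonality relations of the starred idempotents, in coordinates. They hold
  because the \<open>svar l\<close> sum to 0.\<close>

lemma star_coeff_step_Es: "star_coeff (step (Es i) m) j = (if i = j then star_coeff m i else 0)"
proof -
  let ?c = "star_coeff m i"
  have "(\<Sum>l\<in>UNIV. step (Es i) m l * svar l)
      = (\<Sum>l\<in>UNIV. (if l = i then ?c * svar i else 0) - ?c * svar i * svar l)"
    by (rule sum.cong) (auto simp: algebra_simps)
  also have "\<dots> = ?c * svar i - ?c * svar i * (\<Sum>l\<in>UNIV. svar l)"
    by (simp add: sum_subtractf sum_distrib_left)
  finally show ?thesis
    unfolding star_coeff_def[of "step (Es i) m"] by (auto simp: sum_svar algebra_simps)
qed

text \<open>The relation that the starred idempotents sum to 1, in coordinates. The two copies of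
  \<open>?c\<close> cancel, and the last term vanishes by \<open>sum_svar\<close>.\<close>

lemma sum_star_coeff: "(\<Sum>k\<in>UNIV. step (Es k) m l) = m l"
proof -
  let ?c = "\<Sum>j\<in>UNIV. m j * svar j"
  have "(\<Sum>k\<in>UNIV. step (Es k) m l)
      = (\<Sum>k\<in>UNIV. (if k = l then star_coeff m k else 0) - m k * svar k - ?c * svar k)"
    by (rule sum.cong) (auto simp: star_coeff_def algebra_simps)
  also have "\<dots> = star_coeff m l - ?c - ?c * (\<Sum>k\<in>UNIV. svar k)"
    by (simp add: sum_subtractf sum_distrib_left)
  finally show ?thesis by (simp add: sum_svar star_coeff_def)
qed

text \<open>\<open>fold\<close> applies the leftmost letter first, as a right action
  requires.\<close>

definition free_act :: "('i::finite, 'f::field) free_alg \<Rightarrow> ('i \<Rightarrow> ('i, 'f) fralg) \<Rightarrow> 'i \<Rightarrow> ('i, 'f) fralg" where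
  "free_act p m = (\<lambda>j. lin_ext fscale (\<lambda>w. fold step (letters w) m j) p)"

lemma free_act_zero: "free_act 0 m = (\<lambda>_. 0)"
  by (simp add: free_act_def)

lemma free_act_add: "free_act (p + q) m = (\<lambda>j. free_act p m j + free_act q m j)"
  by (simp add: free_act_def lin_ext_add[OF vector_space_fscale])

lemma free_act_diff: "free_act (p - q) m = (\<lambda>j. free_act p m j - free_act q m j)"
  by (simp add: free_act_def lin_ext_diff[OF vector_space_fscale])

lemma free_act_sum: "free_act (sum f S) m = (\<lambda>j. \<Sum>s\<in>S. free_act (f s) m j)"
  by (simp add: free_act_def lin_ext_sum[OF vector_space_fscale])

lemma free_act_fscale: "free_act (fscale c p) m = (\<lambda>j. fscale c (free_act p m j))"
  by (simp add: free_act_def lin_ext_scale[OF vector_space_fscale])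

lemma free_act_single: "free_act (Poly_Mapping.single w c) m = (\<lambda>j. fscale c (fold step (letters w) m j))"
  by (simp add: free_act_def lin_ext_single[OF vector_space_fscale])

lemma free_act_gen: "free_act (free_gen g) m = step g m"
  by (simp add: free_gen_def free_act_single)

lemma free_act_one: "free_act 1 m = m"
  using free_act_single[of 0 1 m] by (simp add: letters_zero)

lemma free_act_add_right: "free_act p (\<lambda>j. m j + m' j) = (\<lambda>j. free_act p m j + free_act p m' j)"
  by (simp add: free_act_def lin_ext_def fold_step_add fs.scale_right_distrib sum.distrib)

lemma free_act_zero_right: "free_act p (\<lambda>_. 0) = (\<lambda>_. 0)"
  using free_act_add_right[of p "\<lambda>_. 0" "\<lambda>_. 0"] by (simp add: fun_eq_iff)

lemma free_act_mult: "free_act (p * q) m = free_act q (free_act p m)"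
proof (induction p rule: poly_mapping_single_induct_UNIV)
  case zero
  then show ?case by (simp add: free_act_zero free_act_zero_right)
next
  case (single v c)
  show ?case
  proof (induction q rule: poly_mapping_single_induct_UNIV)
    case (single w d)
    show ?case
      by (simp add: mult_single free_act_single plus_word_def fold_step_fscale mult.commute)
  qed (simp_all add: free_act_zero free_act_add distrib_left)
next
  case (add p q)
  then show ?case by (simp add: distrib_right free_act_add free_act_add_right)
qed

lemma free_act_relator:
  assumes "r \<in> relators"
  shows "free_act r m = (\<lambda>_. 0)"
proof -
  note act = free_act_diff free_act_mult free_act_gen free_act_one free_act_sum free_act_zero
  from assms consider (a) i j where "r = free_gen (E i) * free_gen (E j) - (if i = j then free_gen (E i) else 0)"
    | (b) i j where "r = free_gen (Es i) * free_gen (Es j) - (if i = j then free_gen (Es i) else 0)"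
    | (c) "r = 1 - (\<Sum>i\<in>UNIV. free_gen (E i))"
    | (d) "r = 1 - (\<Sum>i\<in>UNIV. free_gen (Es i))"
    unfolding relators_def by auto
  then show ?thesis
  proof cases
    case a
    then show ?thesis by (auto simp: act fun_eq_iff)
  next
    case b
    have "step (Es j) (step (Es i) m) = (if i = j then step (Es i) m else (\<lambda>_. 0))"
      unfolding step.simps(2)[of j] star_coeff_step_Es by auto
    with b show ?thesis by (auto simp: act simp del: step.simps)
  next
    case c
    then show ?thesis by (auto simp: act)
  next
    case d
    then show ?thesis by (simp add: act sum_star_coeff del: step.simps)
  qed
qed

text \<open>A left multiple \<open>a * x\<close> acts as \<open>x\<close> on the row
  \<open>free_act a m\<close>, so the induction must range over all rows.\<close>

lemma free_act_ideal: "r \<in> two_sided_ideal relators \<Longrightarrow> free_act r m = (\<lambda>_. 0)"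
  by (induction arbitrary: m rule: two_sided_ideal.induct)
    (simp_all add: free_act_relator free_act_zero free_act_add free_act_mult free_act_zero_right)

lift_definition act :: "('i::finite, 'f::field) alg \<Rightarrow> ('i \<Rightarrow> ('i, 'f) fralg) \<Rightarrow> 'i \<Rightarrow> ('i, 'f) fralg"
  is free_act
proof -
  fix p q :: "('i, 'f) free_alg"
  assume "alg_cong p q"
  then have "free_act (p - q) m = (\<lambda>_. 0)" for m
    unfolding alg_cong_def by (rule free_act_ideal)
  then show "free_act p = free_act q"
    by (simp add: fun_eq_iff free_act_diff)
qed

lemma act_zero: "act 0 m = (\<lambda>_. 0)"
  by transfer (rule free_act_zero)

lemma act_add: "act (a + b) m = (\<lambda>j. act a m j + act b m j)"
  by transfer (rule free_act_add)

lemma act_diff: "act (a - b) m = (\<lambda>j. act a m j - act b m j)"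
  by transfer (rule free_act_diff)

lemma act_sum: "act (sum f S) m = (\<lambda>j. \<Sum>s\<in>S. act (f s) m j)"
  by (induction S rule: infinite_finite_induct) (simp_all add: act_zero act_add)

lemma act_ascale: "act (ascale c a) m = (\<lambda>j. fscale c (act a m j))"
  by transfer (rule free_act_fscale)

lemma act_mult: "act (a * b) m = act b (act a m)"
  by transfer (rule free_act_mult)

lemma act_one: "act 1 m = m"
  by transfer (rule free_act_one)

lemma act_agen: "act (agen g) m = step g m"
  by transfer (rule free_act_gen)


subsection \<open>The elements s_i and the subalgebra they generate\<close>

definition sgen :: "'i \<Rightarrow> ('i::finite, 'f::field) alg" where
  "sgen i = agen (E i) - agen (Es i)"

abbreviation sprod :: "'i list \<Rightarrow> ('i::finite, 'f::field) alg" where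
  "sprod w \<equiv> prod_list (map sgen w)"

definition S_sub :: "nat \<Rightarrow> ('i::finite, 'f::field) alg set" where
  "S_sub n = alg.span {sprod w | w. length w = n}"

definition S_alg :: "('i::finite, 'f::field) alg set" where
  "S_alg = alg.span (range sprod)"

lemma subspace_S_sub: "alg.subspace (S_sub n)"
  unfolding S_sub_def by (rule alg.subspace_span)

lemma subspace_S_alg: "alg.subspace S_alg"
  unfolding S_alg_def by (rule alg.subspace_span)

lemma sprod_in_S_sub: "length w = n \<Longrightarrow> sprod w \<in> S_sub n"
  unfolding S_sub_def by (rule alg.span_base) auto

lemma sprod_in_S_alg: "sprod w \<in> S_alg"
  unfolding S_alg_def by (rule alg.span_base) auto

lemma S_sub_subset_S_alg: "S_sub n \<subseteq> S_alg"
  unfolding S_sub_def S_alg_def by (rule alg.span_mono) auto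

lemma sum_sgen: "(\<Sum>i\<in>UNIV. sgen i) = 0"
  by (simp add: sgen_def sum_subtractf sum_agen_E sum_agen_Es)

lemma S_alg_mult_sgen:
  assumes "x \<in> S_alg"
  shows "x * sgen i \<in> S_alg"
  using assms unfolding S_alg_def
proof (induction rule: alg.span_induct_alt)
  case base
  show ?case by (simp add: alg.span_zero)
next
  case (step c x y)
  then obtain w where x: "x = sprod w" by blast
  have "sprod (w @ [i]) \<in> alg.span (range sprod)"
    by (rule alg.span_base) blast
  then show ?case
    using step(2) by (auto simp: x distrib_right ascale_mult_left intro!: alg.span_add alg.span_scale)
qed

lemma star_zero: "star 0 = 0"
  using star_add[of 0 0] by simp

lemma star_uminus: "star (- x) = - star x"
proof -
  have "star x + star (- x) = 0"
    by (simp add: star_zero flip: star_add)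
  then show ?thesis by (metis minus_unique)
qed

lemma star_diff: "star (x - y) = star x - star y"
  using star_add[of x "- y"] by (simp add: star_uminus)

lemma star_sum: "star (sum f S) = (\<Sum>s\<in>S. star (f s))"
  by (induction S rule: infinite_finite_induct) (simp_all add: star_zero star_add)

lemma star_sgen: "star (sgen i) = - sgen i"
  by (simp add: sgen_def star_diff star_agen)

lemma star_sprod: "star (sprod w) = ascale ((- 1) ^ length w) (sprod w)"
  by (induction w) (simp_all add: star_one star_mult star_sgen ascale_mult_right)

text \<open>Products of \<open>n\<close> factors are eigenvectors of \<open>star\<close> with
  eigenvalue \<open>(- 1) ^ n\<close>. This lets \<open>star\<close> carry expansions over the
  \<open>e\<^sub>j\<close> to expansions over the \<open>e\<^sup>*\<^sub>j\<close> with coefficients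
  still in \<open>S_sub n\<close>.\<close>

lemma star_S_sub:
  assumes "x \<in> S_sub n"
  shows "star x \<in> S_sub n"
  using assms unfolding S_sub_def
proof (induction rule: alg.span_induct_alt)
  case base
  show ?case by (simp add: star_zero alg.span_zero)
next
  case (step c x y)
  then obtain w where x: "x = sprod w" "length w = n" by blast
  have "x \<in> alg.span {sprod w | w. length w = n}"
    using step by (intro alg.span_base)
  then show ?case
    using step(2) by (simp add: x(1) star_add star_scale star_sprod alg.span_add alg.span_scale)
qed

text \<open>On a constant row the sum in \<open>star_coeff\<close> vanishes by
  \<open>sum_svar\<close>, so the delta terms of \<open>E i\<close> and \<open>Es i\<close> cancel
  and only \<open>p * svar i\<close> remains.\<close>

lemma act_sgen: "act (sgen i) (\<lambda>_. p) = (\<lambda>_. p * svar i)"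
proof
  fix l
  have "star_coeff (\<lambda>_. p) i = p"
    by (simp add: star_coeff_def sum_svar flip: sum_distrib_left)
  then show "act (sgen i) (\<lambda>_. p) l = p * svar i"
    by (simp add: sgen_def act_diff act_agen algebra_simps)
qed

lemma act_sprod: "act (sprod w) (\<lambda>_. p) = (\<lambda>_. p * prod_list (map svar w))"
  by (induction w arbitrary: p) (simp_all add: act_one act_mult act_sgen mult.assoc)

text \<open>On the subalgebra generated by the \<open>s\<^sub>i\<close> the row vector is constant, so any coordinate will do.\<close>

definition coeff :: "('i::finite, 'f::field) alg \<Rightarrow> ('i, 'f) fralg" where
  "coeff x = act x (\<lambda>_. 1) undefined"

lemma coeff_add: "coeff (x + y) = coeff x + coeff y"
  by (simp add: coeff_def act_add)

lemma coeff_ascale: "coeff (ascale c x) = fscale c (coeff x)"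
  by (simp add: coeff_def act_ascale)

lemma coeff_zero: "coeff 0 = 0"
  by (simp add: coeff_def act_zero)

lemma coeff_sprod: "coeff (sprod w) = prod_list (map svar w)"
  by (simp add: coeff_def act_sprod)

lemma act_S_alg:
  assumes "x \<in> S_alg"
  shows "act x (\<lambda>_. 1) = (\<lambda>_. coeff x)"
  using assms unfolding S_alg_def
proof (induction rule: alg.span_induct_alt)
  case base
  show ?case by (simp add: act_zero coeff_zero)
next
  case (step c x y)
  then show ?case by (auto simp: act_add act_ascale coeff_add coeff_ascale act_sprod coeff_sprod)
qed

lemma homogeneous_coeff:
  assumes "x \<in> S_sub n"
  shows "homogeneous n (coeff x)"
  using assms unfolding S_sub_def
proof (induction rule: alg.span_induct_alt)
  case base
  show ?case by (simp add: coeff_zero homogeneous_zero)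
next
  case (step c x y)
  then show ?case
    using homogeneous_prod_svar
    by (auto simp: coeff_add coeff_ascale coeff_sprod intro!: homogeneous_add homogeneous_fscale)
qed

section \<open>Evaluation of the free algebra in A, and injectivity of \<open>coeff\<close>\<close>

definition eval_s :: "('i::finite, 'f::field) fralg \<Rightarrow> ('i, 'f) alg" where
  "eval_s = lin_ext ascale (\<lambda>w. sprod (letters w))"

lemma eval_s_add: "eval_s (p + q) = eval_s p + eval_s q"
  unfolding eval_s_def by (rule lin_ext_add[OF vector_space_ascale])

lemma eval_s_fscale: "eval_s (fscale c p) = ascale c (eval_s p)"
  unfolding eval_s_def by (rule lin_ext_scale[OF vector_space_ascale])

lemma eval_s_mult: "eval_s (p * q) = eval_s p * eval_s q"
  unfolding eval_s_def
  by (rule lin_ext_mult[OF vector_space_ascale])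
    (auto simp: ascale_mult_left ascale_mult_right plus_word_def)

lemma eval_s_one: "eval_s 1 = 1"
  unfolding eval_s_def
  using lin_ext_single[OF vector_space_ascale, of "\<lambda>w. sprod (letters w)" 0 1]
  by (simp add: letters_zero)

text \<open>At the eliminated index this is the relation \<open>sum_sgen\<close>, which holds in A
  as well.\<close>

lemma eval_s_svar: "eval_s (svar i) = (sgen i :: ('i::finite, 'f::field) alg)"
proof -
  have var: "eval_s (var j) = (sgen j :: ('i, 'f) alg)" for j
    by (simp add: eval_s_def var_def lin_ext_single[OF vector_space_ascale])
  have "(\<Sum>i\<in>UNIV. sgen i) = sgen undefined + (\<Sum>i\<in>UNIV - {undefined}. sgen i :: ('i, 'f) alg)"
    by (rule sum.remove) auto
  then have "sgen undefined = - (\<Sum>i\<in>UNIV - {undefined}. sgen i :: ('i, 'f) alg)"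
    by (simp add: sum_sgen eq_neg_iff_add_eq_0)
  moreover have "eval_s (- p) = - eval_s p" for p :: "('i, 'f) fralg"
    using eval_s_fscale[of "- 1" p] by simp
  moreover have "eval_s (sum f S) = (\<Sum>s\<in>S. eval_s (f s))" for S :: "'i set" and f :: "'i \<Rightarrow> ('i, 'f) fralg"
    unfolding eval_s_def by (rule lin_ext_sum[OF vector_space_ascale])
  ultimately show ?thesis
    by (simp add: svar_def var)
qed

lemma eval_s_prod: "eval_s (prod_list (map svar w)) = sprod w"
  by (induction w) (simp_all add: eval_s_one eval_s_mult eval_s_svar)

text \<open>Evaluation undoes \<open>coeff\<close> on each product of the \<open>sgen i\<close>,
  hence on their span; \<open>coeff_inj\<close> follows.\<close>

lemma eval_s_coeff:
  assumes "x \<in> S_alg"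
  shows "eval_s (coeff x) = x"
  using assms unfolding S_alg_def
proof (induction rule: alg.span_induct_alt)
  case base
  show ?case by (simp add: coeff_zero eval_s_def)
next
  case (step c x y)
  then show ?case by (auto simp: coeff_add coeff_ascale coeff_sprod eval_s_add eval_s_fscale eval_s_prod)
qed

lemma coeff_inj: "x \<in> S_alg \<Longrightarrow> y \<in> S_alg \<Longrightarrow> coeff x = coeff y \<Longrightarrow> x = y"
  by (metis eval_s_coeff)

subsection \<open>A as a free left module over the subalgebra\<close>

lemma act_sum_E:
  assumes "range u \<subseteq> S_alg"
  shows "act (\<Sum>j\<in>UNIV. u j * agen (E j)) (\<lambda>_. 1) = (\<lambda>l. coeff (u l))"
  using assms by (simp add: act_sum act_mult act_agen act_S_alg image_subset_iff)

lemma act_sum_Es: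
  fixes u :: "'i::finite \<Rightarrow> ('i, 'f::field) alg"
  assumes "range u \<subseteq> S_alg"
  shows "act (\<Sum>j\<in>UNIV. u j * agen (Es j)) (\<lambda>_. 1)
    = (\<lambda>l. coeff (u l) - (\<Sum>k\<in>UNIV. coeff (u k) * svar k))"
proof
  fix l
  have "star_coeff (\<lambda>_. p) k = p" for p :: "('i, 'f) fralg" and k
    by (simp add: star_coeff_def sum_svar flip: sum_distrib_left)
  then have "act (\<Sum>j\<in>UNIV. u j * agen (Es j)) (\<lambda>_. 1) l
     = (\<Sum>k\<in>UNIV. coeff (u k) * ((if l = k then 1 else 0) - svar k))"
    using assms by (simp add: act_sum act_mult act_agen act_S_alg image_subset_iff)
  also have "\<dots> = (\<Sum>k\<in>UNIV. (if l = k then coeff (u k) else 0) - coeff (u k) * svar k)"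
    by (rule sum.cong) (auto simp: algebra_simps)
  finally show "act (\<Sum>j\<in>UNIV. u j * agen (Es j)) (\<lambda>_. 1) l
      = coeff (u l) - (\<Sum>k\<in>UNIV. coeff (u k) * svar k)"
    by (simp add: sum_subtractf)
qed

lemma independent_E:
  assumes "range u \<subseteq> S_alg" "(\<Sum>j\<in>UNIV. u j * agen (E j)) = 0"
  shows "u = (\<lambda>_. 0)"
proof
  fix l
  have "coeff (u l) = coeff 0"
    using fun_cong[OF act_sum_E[OF assms(1)], of l] assms(2) by (simp add: act_zero coeff_zero)
  then show "u l = 0"
    using assms(1) alg.subspace_0[OF subspace_S_alg] by (intro coeff_inj) auto
qed

text \<open>By \<open>act_sum_Es\<close> all coordinates equal the same \<open>c\<close>, the sum of
  the \<open>coeff (u k) * svar k\<close>. Then \<open>c\<close> is \<open>c\<close> times the sum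
  of the \<open>svar k\<close>, which is 0.\<close>

lemma independent_Es:
  assumes "range u \<subseteq> S_alg" "(\<Sum>j\<in>UNIV. u j * agen (Es j)) = 0"
  shows "u = (\<lambda>_. 0)"
proof
  fix l
  define c where "c = (\<Sum>k\<in>UNIV. coeff (u k) * svar k)"
  have *: "coeff (u l) = c" for l
    using fun_cong[OF act_sum_Es[OF assms(1)], of l] assms(2) by (simp add: act_zero c_def)
  have "c = c * (\<Sum>k\<in>UNIV. svar k)"
    unfolding sum_distrib_left by (subst c_def) (simp add: *)
  then have "coeff (u l) = coeff 0"
    by (simp add: * coeff_zero sum_svar)
  then show "u l = 0"
    using assms(1) alg.subspace_0[OF subspace_S_alg] by (intro coeff_inj) auto
qed

section \<open>Existence of expansions over the \<open>e\<^sub>j\<close> and over the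
  \<open>e\<^sup>*\<^sub>j\<close>\<close>

definition E_span :: "('i::finite, 'f::field) alg set \<Rightarrow> ('i, 'f) alg set" where
  "E_span U = {\<Sum>j\<in>UNIV. u j * agen (E j) | u. range u \<subseteq> U}"

lemma subspace_E_span:
  assumes "alg.subspace U"
  shows "alg.subspace (E_span U)"
proof (rule alg.subspaceI)
  show "0 \<in> E_span U"
    unfolding E_span_def using alg.subspace_0[OF assms] by (auto intro!: exI[of _ "\<lambda>_. 0"])
next
  fix x y assume "x \<in> E_span U" "y \<in> E_span U"
  then obtain u v where "range u \<subseteq> U" "x = (\<Sum>j\<in>UNIV. u j * agen (E j))"
    "range v \<subseteq> U" "y = (\<Sum>j\<in>UNIV. v j * agen (E j))"
    unfolding E_span_def by blast
  then show "x + y \<in> E_span U"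
    unfolding E_span_def using alg.subspace_add[OF assms]
    by (auto intro!: exI[of _ "\<lambda>j. u j + v j"] simp: distrib_right sum.distrib)
next
  fix c x assume "x \<in> E_span U"
  then obtain u where "range u \<subseteq> U" "x = (\<Sum>j\<in>UNIV. u j * agen (E j))"
    unfolding E_span_def by blast
  then show "ascale c x \<in> E_span U"
    unfolding E_span_def using alg.subspace_scale[OF assms]
    by (auto intro!: exI[of _ "\<lambda>j. ascale c (u j)"] simp: alg.scale_sum_right ascale_mult_left)
qed

lemma E_span_base:
  assumes "alg.subspace U" "x \<in> U"
  shows "x * agen (E j) \<in> E_span U"
  unfolding E_span_def
  using assms alg.subspace_0[OF assms(1)]
  by (auto intro!: exI[of _ "\<lambda>k. if k = j then x else 0"] simp: if_distrib[of "\<lambda>y. y * _"] cong: if_cong)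

text \<open>The right factor is \<open>agen (Es k)\<close>, and the delta compensates for the
  product of \<open>agen (Es j)\<close> with it.\<close>

lemma agen_E_Es: "agen (E j) * agen (Es k) = (sgen j + (if j = k then 1 else 0)) * (agen (E k) - sgen k)"
  by (simp add: sgen_def algebra_simps agen_Es_mult)

lemma E_span_mult_agen:
  assumes "x \<in> E_span S_alg"
  shows "x * agen g \<in> E_span S_alg"
proof -
  obtain u where u: "range u \<subseteq> S_alg" and x: "x = (\<Sum>j\<in>UNIV. u j * agen (E j))"
    using assms unfolding E_span_def by blast
  show ?thesis
  proof (cases g)
    case (E k)
    have "x * agen g = (\<Sum>j\<in>UNIV. if j = k then u j * agen (E j) else 0)"
      unfolding x E sum_distrib_right by (rule sum.cong) (simp_all add: mult.assoc agen_E_mult)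
    then show ?thesis
      using E_span_base[OF subspace_S_alg, of "u k" k] u by auto
  next
    case (Es k)
    \<comment> \<open>The counterpart of \<open>star_coeff\<close> inside A.\<close>
    define t where "t = (\<Sum>j\<in>UNIV. u j * (sgen j + (if j = k then 1 else 0)))"
    have t: "t \<in> S_alg"
      unfolding t_def
    proof (rule alg.subspace_sum[OF subspace_S_alg])
      fix j
      have "u j * sgen j + (if j = k then u j else 0) \<in> S_alg"
        using u S_alg_mult_sgen[of "u j" j]
        by (auto intro: alg.subspace_add[OF subspace_S_alg])
      then show "u j * (sgen j + (if j = k then 1 else 0)) \<in> S_alg"
        by (auto simp: algebra_simps split: if_splits)
    qed
    \<comment> \<open>Inserting 1 as the sum of the \<open>agen (E l)\<close> makes every term end
      in a nonstarred generator.\<close>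
    have "x * agen g = t * (agen (E k) - sgen k * (\<Sum>l\<in>UNIV. agen (E l)))"
      unfolding x Es t_def sum_distrib_right sum_agen_E
      by (rule sum.cong) (simp_all add: mult.assoc agen_E_Es)
    also have "\<dots> = t * agen (E k) - (\<Sum>l\<in>UNIV. t * sgen k * agen (E l))"
      by (simp add: algebra_simps sum_distrib_left)
    also have "\<dots> \<in> E_span S_alg"
      by (intro alg.subspace_diff alg.subspace_sum subspace_E_span subspace_S_alg E_span_base t S_alg_mult_sgen)
    finally show ?thesis .
  qed
qed

lemma prod_agen_in_E_span: "prod_list (map agen w) \<in> E_span S_alg"
proof (induction w rule: rev_induct)
  case Nil
  have "(\<Sum>j\<in>UNIV. sprod [] * agen (E j)) \<in> E_span S_alg"
    by (intro alg.subspace_sum E_span_base subspace_E_span subspace_S_alg sprod_in_S_alg)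
  then show ?case by (simp add: sum_agen_E)
next
  case (snoc g w)
  then show ?case by (simp add: E_span_mult_agen)
qed

text \<open>A is a quotient of the free algebra, hence spanned by the products of generators handled
  in \<open>prod_agen_in_E_span\<close>.\<close>

lemma E_span_S_alg: "(x :: ('i::finite, 'f::field) alg) \<in> E_span S_alg"
proof -
  have "abs_alg p \<in> E_span S_alg" for p :: "('i, 'f) free_alg"
  proof (induction p rule: poly_mapping_single_induct_UNIV)
    case zero
    show ?case
      using alg.subspace_0[OF subspace_E_span[OF subspace_S_alg]] by (simp add: zero_alg_def)
  next
    case (single x c)
    have "abs_alg (Poly_Mapping.single (Word w) 1) = (prod_list (map agen w) :: ('i, 'f) alg)" for w
    proof (induction w)
      case Nil
      show ?case by (simp add: one_alg_def flip: zero_word_def)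
    next
      case (Cons g w)
      have "Poly_Mapping.single (Word (g # w)) 1 = free_gen g * (Poly_Mapping.single (Word w) 1 :: ('i, 'f) free_alg)"
        by (simp add: free_gen_def mult_single plus_word_def)
      then show ?case
        using Cons by (simp add: agen.abs_eq flip: times_alg.abs_eq)
    qed
    from this[of "letters x"]
    have "abs_alg (Poly_Mapping.single x c) = (ascale c (prod_list (map agen (letters x))) :: ('i, 'f) alg)"
      using ascale.abs_eq[of c "Poly_Mapping.single x (1::'f)"] by simp
    then show ?case
      by (simp add: alg.subspace_scale[OF subspace_E_span[OF subspace_S_alg]] prod_agen_in_E_span)
  next
    case (add p q)
    then show ?case
      using alg.subspace_add[OF subspace_E_span[OF subspace_S_alg]] by (simp flip: plus_alg.abs_eq)
  qed
  then show ?thesis by (induction x rule: alg.abs_induct)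
qed

lemma expansion_E: "\<exists>u. range u \<subseteq> S_alg \<and> x = (\<Sum>j\<in>UNIV. u j * agen (E j))"
  using E_span_S_alg[of x] unfolding E_span_def by blast

text \<open>Each \<open>agen (E j)\<close> is \<open>agen (Es j) + sgen j\<close>. The leftover
  \<open>?c\<close> in \<open>S_alg\<close> is distributed over all coordinates by writing 1 as the
  sum of the \<open>agen (Es j)\<close>.\<close>

lemma expansion_Es: "\<exists>u. range u \<subseteq> S_alg \<and> x = (\<Sum>j\<in>UNIV. u j * agen (Es j))"
proof -
  obtain u where u: "range u \<subseteq> S_alg" and x: "x = (\<Sum>j\<in>UNIV. u j * agen (E j))"
    using expansion_E by blast
  let ?c = "\<Sum>j\<in>UNIV. u j * sgen j"
  have "x = (\<Sum>j\<in>UNIV. u j * agen (Es j)) + ?c"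
    unfolding x sum.distrib[symmetric] by (rule sum.cong) (simp_all add: sgen_def algebra_simps)
  also have "?c = ?c * (\<Sum>j\<in>UNIV. agen (Es j))"
    by (simp add: sum_agen_Es)
  also have "(\<Sum>j\<in>UNIV. u j * agen (Es j)) + \<dots> = (\<Sum>j\<in>UNIV. (u j + ?c) * agen (Es j))"
    by (simp add: sum_distrib_left distrib_right sum.distrib)
  finally have "x = (\<Sum>j\<in>UNIV. (u j + ?c) * agen (Es j))" .
  moreover have "range (\<lambda>j. u j + ?c) \<subseteq> S_alg"
    using u by (auto intro!: alg.subspace_add[OF subspace_S_alg] alg.subspace_sum[OF subspace_S_alg]
        S_alg_mult_sgen)
  ultimately show ?thesis by blast
qed


subsection \<open>Nonrepeating words\<close>

lemma subspace_A_sub: "alg.subspace (A_sub n)"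
  unfolding A_sub_def by (rule alg.subspace_span)

text \<open>Of the two terms of \<open>sgen (index g)\<close>, the one of the same type as
  \<open>h\<close> kills \<open>h\<close>, because the indices differ; the other is \<open>g\<close>
  up to sign.\<close>

lemma sgen_mult_agen_distinct:
  assumes "index g \<noteq> index h" "starred g \<noteq> starred h"
  shows "sgen (index g) * agen h = (if starred g then - (agen g * agen h) else agen g * agen h)"
  using assms by (cases g; cases h) (auto simp: sgen_def left_diff_distrib agen_E_mult agen_Es_mult)

text \<open>Every letter except the last is replaced by its \<open>sgen\<close>, at the cost of a
  sign; \<open>c\<close> collects these signs.\<close>

lemma prod_nonrepeating:
  fixes w :: "'i::finite gen list"
  assumes "is_word w" "nonrepeating w"
  shows "\<exists>(c::'f::field) v. length v = length w - 1 \<and> prod_list (map agen w) = ascale c (sprod v * agen (last w))"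
  using assms
proof (induction w)
  case Nil
  then show ?case by (simp add: is_word_def)
next
  case (Cons g w)
  show ?case
  proof (cases w)
    case Nil
    then show ?thesis by (intro exI[of _ 1] exI[of _ "[]"]) simp
  next
    case (Cons h w')
    then have gh: "index g \<noteq> index h" "starred g \<noteq> starred h" and w: "is_word w" "nonrepeating w"
      using Cons.prems by (auto simp: is_word_def nonrepeating_def)
    obtain c :: 'f and v where v: "length v = length w - 1" "prod_list (map agen w) = ascale c (sprod v * agen (last w))"
      using Cons.IH w by blast
    have "agen g * agen h = ascale (if starred g then - 1 else (1::'f)) (sgen (index g) * agen h)"
      by (simp add: sgen_mult_agen_distinct[OF gh])
    then have "prod_list (map agen (g # w))
        = ascale (if starred g then - 1 else (1::'f)) (sgen (index g) * prod_list (map agen w))"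
      by (simp add: Cons ascale_mult_left flip: mult.assoc del: if_split)
    also have "\<dots> = ascale ((if starred g then - 1 else 1) * c) (sprod (index g # v) * agen (last w))"
      by (simp only: v(2) ascale_mult_right alg.scale_scale list.map prod_list.Cons mult.assoc)
    finally have "prod_list (map agen (g # w))
        = ascale ((if starred g then - 1 else 1) * c) (sprod (index g # v) * agen (last (g # w)))"
      using Cons by simp
    moreover have "length (index g # v) = length (g # w) - 1"
      using v(1) Cons by simp
    ultimately show ?thesis by blast
  qed
qed

lemma A_sub_subset_E_span: "(A_sub (Suc n) :: ('i::finite, 'f::field) alg set) \<subseteq> E_span (S_sub n)"
proof -
  have "prod_list (map agen w) \<in> E_span (S_sub n :: ('i, 'f) alg set)"
    if w: "is_word w" "nonrepeating w" "length w = Suc n" "\<not> starred (last w)" for w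
  proof -
    obtain c :: 'f and v where v: "length v = n" "prod_list (map agen w) = ascale c (sprod v * agen (last w))"
      using prod_nonrepeating[OF w(1,2)] w(3) by auto
    obtain j where "last w = E j"
      using w(4) by (cases "last w") auto
    then show ?thesis
      unfolding v(2)
      by (simp add: alg.subspace_scale[OF subspace_E_span[OF subspace_S_sub]]
          E_span_base[OF subspace_S_sub] sprod_in_S_sub[OF v(1)])
  qed
  then show ?thesis
    unfolding A_sub_def by (intro alg.span_minimal subspace_E_span subspace_S_sub) blast
qed

text \<open>Here \<open>sgen i\<close> acts as \<open>1 - agen (Es i)\<close> on
  \<open>agen (E i)\<close> and as \<open>agen (E i) - 1\<close> on \<open>agen (Es i)\<close>;
  these are, up to sign, sums of the remaining idempotents of one type.\<close>

lemma sgen_mult_agen_same: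
  fixes i :: "'i::finite"
  shows "(sgen i :: ('i, 'f::field) alg) * agen (E i) = (\<Sum>k\<in>UNIV - {i}. agen (Es k) * agen (E i))"
    "(sgen i :: ('i, 'f::field) alg) * agen (Es i) = - (\<Sum>k\<in>UNIV - {i}. agen (E k) * agen (Es i))"
proof -
  have "(\<Sum>k\<in>UNIV - {i}. agen (Es k)) = (1 - agen (Es i) :: ('i, 'f) alg)"
    "(\<Sum>k\<in>UNIV - {i}. agen (E k)) = (1 - agen (E i) :: ('i, 'f) alg)"
    by (simp_all add: sum_diff1 sum_agen_E sum_agen_Es)
  then show "(sgen i :: ('i, 'f) alg) * agen (E i) = (\<Sum>k\<in>UNIV - {i}. agen (Es k) * agen (E i))"
    "(sgen i :: ('i, 'f) alg) * agen (Es i) = - (\<Sum>k\<in>UNIV - {i}. agen (E k) * agen (Es i))"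
    by (simp_all add: sgen_def left_diff_distrib agen_E_mult agen_Es_mult flip: sum_distrib_right)
qed

text \<open>Up to sign, \<open>sgen i\<close> times a nonrepeating word is one longer nonrepeating
  word if \<open>i\<close> differs from the first index, and otherwise a sum of such words over all
  \<open>k\<close> other than \<open>i\<close>. The last letter never changes.\<close>

lemma sgen_mult_A_sub:
  fixes x :: "('i::finite, 'f::field) alg"
  assumes "x \<in> A_sub (Suc n)"
  shows "sgen i * x \<in> A_sub (Suc (Suc n))"
proof -
  let ?P = "\<lambda>w. prod_list (map agen w) :: ('i, 'f) alg"
  let ?W = "\<lambda>n. {?P w | w. is_word w \<and> nonrepeating w \<and> length w = n \<and> \<not> starred (last w)}"
  have word: "sgen i * ?P w \<in> A_sub (Suc (Suc n))"
    if w: "is_word w" "nonrepeating w" "length w = Suc n" "\<not> starred (last w)" for w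
  proof -
    obtain h w' where hw: "w = h # w'"
      using w(3) by (cases w) auto
    \<comment> \<open>The generator of index \<open>k\<close> whose type is opposite to
      \<open>h\<close>, so that prepending it keeps the word alternating.\<close>
    define opp where "opp k = (if starred h then E k else Es k)" for k :: 'i
    have opp: "agen (opp k) * agen h * ?P w' \<in> A_sub (Suc (Suc n))" if "k \<noteq> index h" for k
    proof -
      have "?P (opp k # w) \<in> ?W (Suc (Suc n))"
        using w that by (intro CollectI exI[of _ "opp k # w"])
          (auto simp: hw opp_def is_word_def nonrepeating_def)
      then show ?thesis
        unfolding A_sub_def by (auto simp: hw mult.assoc intro: alg.span_base)
    qed
    show ?thesis
    proof (cases "i = index h")
      case True
      have "sgen i * ?P w = (\<Sum>k\<in>UNIV - {i}. agen (opp k) * agen h * ?P w') \<or>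
        sgen i * ?P w = - (\<Sum>k\<in>UNIV - {i}. agen (opp k) * agen h * ?P w')"
        using True by (cases h)
          (simp_all add: sgen_mult_agen_same hw opp_def sum_distrib_right flip: mult.assoc)
      moreover have "(\<Sum>k\<in>UNIV - {i}. agen (opp k) * agen h * ?P w') \<in> A_sub (Suc (Suc n))"
        using True by (intro alg.subspace_sum[OF subspace_A_sub] opp) auto
      ultimately show ?thesis
        using alg.subspace_neg[OF subspace_A_sub] by metis
    next
      case False
      then have "sgen i * ?P w = agen (opp i) * agen h * ?P w' \<or>
        sgen i * ?P w = - (agen (opp i) * agen h * ?P w')"
        using sgen_mult_agen_distinct[of "opp i" h, where 'b = 'f]
        by (auto simp: hw opp_def simp flip: mult.assoc)
      then show ?thesis
        using opp False alg.subspace_neg[OF subspace_A_sub] by metis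
    qed
  qed
  show ?thesis
    using assms unfolding A_sub_def[of "Suc n"]
  proof (induction rule: alg.span_induct_alt)
    case base
    show ?case
      using alg.subspace_0[OF subspace_A_sub] by simp
  next
    case (step c x y)
    then show ?case
      using word by (auto simp: distrib_left ascale_mult_right
          intro!: alg.subspace_add[OF subspace_A_sub] alg.subspace_scale[OF subspace_A_sub])
  qed
qed

lemma A_sub_1: "(A_sub 1 :: ('i::finite, 'f::field) alg set) = alg.span (range (\<lambda>j. agen (E j)))"
proof -
  have "{prod_list (map agen w) :: ('i, 'f) alg | w. is_word w \<and> nonrepeating w \<and> length w = 1 \<and> \<not> starred (last w)}
    = range (\<lambda>j. agen (E j))" (is "?L = ?R")
  proof
    show "?L \<subseteq> ?R"
    proof
      fix x assume "x \<in> ?L"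
      then obtain g where "x = agen g" "\<not> starred g"
        by (auto simp: length_Suc_conv)
      then show "x \<in> ?R" by (cases g) auto
    qed
    show "?R \<subseteq> ?L"
      by (auto intro!: exI[of _ "[E _]"] simp: is_word_def nonrepeating_def)
  qed
  then show ?thesis by (simp only: A_sub_def)
qed

lemma As_sub_1: "(As_sub 1 :: ('i::finite, 'f::field) alg set) = alg.span (range (\<lambda>j. agen (Es j)))"
proof -
  have "module_hom ascale ascale (star :: ('i, 'f) alg \<Rightarrow> _)"
    by unfold_locales (simp_all add: star_add star_scale)
  then show ?thesis
    unfolding As_sub_def A_sub_1
    by (simp add: module_hom.span_image[symmetric] image_image star_agen)
qed

text \<open>The empty product 1 is a sum of words of length 1 of either type, hence the shift by
  \<open>Suc\<close>. Since \<open>star\<close> negates \<open>sgen i\<close>, left multiplication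
  by \<open>sgen i\<close> raises the length on the starred side too.\<close>

lemma sprod_in_A_sub:
  "(sprod w :: ('i::finite, 'f::field) alg) \<in> A_sub (Suc (length w)) \<and> (sprod w :: ('i, 'f) alg) \<in> As_sub (Suc (length w))"
proof (induction w)
  case Nil
  have "(1 :: ('i, 'f) alg) \<in> A_sub 1"
    unfolding A_sub_1 sum_agen_E[symmetric] by (intro alg.span_sum alg.span_base) auto
  moreover have "(1 :: ('i, 'f) alg) \<in> As_sub 1"
    unfolding As_sub_1 sum_agen_Es[symmetric] by (intro alg.span_sum alg.span_base) auto
  ultimately show ?case by simp
next
  case (Cons i w)
  then obtain x :: "('i, 'f) alg" where x: "x \<in> A_sub (Suc (length w))" "sprod w = star x"
    unfolding As_sub_def by blast
  have "sprod (i # w) = star (- (sgen i * x))"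
    by (simp add: x(2) star_uminus star_mult star_sgen)
  moreover have "- (sgen i * x) \<in> A_sub (Suc (Suc (length w)))"
    by (intro alg.subspace_neg[OF subspace_A_sub] sgen_mult_A_sub x(1))
  ultimately have "sprod (i # w) \<in> (As_sub (Suc (Suc (length w))) :: ('i, 'f) alg set)"
    unfolding As_sub_def by (rule image_eqI)
  then show ?case
    using Cons by (simp add: sgen_mult_A_sub)
qed

section \<open>Identification of F with the span of the products of the
  \<open>sgen i\<close>\<close>

lemma inter_subset_S_sub: "A_sub (Suc n) \<inter> As_sub (Suc n) \<subseteq> S_sub n"
proof
  fix x assume x: "x \<in> A_sub (Suc n) \<inter> As_sub (Suc n)"
  then obtain y where y: "range y \<subseteq> S_sub n" "x = (\<Sum>j\<in>UNIV. y j * agen (E j))"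
    using A_sub_subset_E_span unfolding E_span_def by blast
  obtain a where a: "a \<in> A_sub (Suc n)" "x = star a"
    using x unfolding As_sub_def by blast
  then obtain b where b: "range b \<subseteq> S_sub n" "a = (\<Sum>j\<in>UNIV. b j * agen (E j))"
    using A_sub_subset_E_span unfolding E_span_def by blast
  define z where "z j = star (b j)" for j
  have z: "z j \<in> S_sub n" for j
    using b(1) star_S_sub by (auto simp: z_def)
  have xz: "x = (\<Sum>j\<in>UNIV. z j * agen (Es j))"
    by (simp add: a(2) b(2) z_def star_sum star_mult star_agen)
  let ?c = "\<Sum>k\<in>UNIV. coeff (z k) * svar k"
  \<comment> \<open>Both sides are coordinate \<open>l\<close> of the image under
    \<open>act x\<close> of the constant row 1.\<close>
  have "coeff (y l) = coeff (z l) - ?c" for l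
  proof -
    have "range y \<subseteq> S_alg" "range z \<subseteq> S_alg"
      using y(1) z S_sub_subset_S_alg by blast+
    from act_sum_E[OF this(1)] act_sum_Es[OF this(2)] show ?thesis
      using y(2) xz by (metis (no_types, lifting))
  qed
  then have "?c = coeff (z l) - coeff (y l)" for l
    by simp
  \<comment> \<open>Degree \<open>n\<close> comes from \<open>?c\<close> as a difference of
    coordinates, degree \<open>n + 1\<close> below from its definition.\<close>
  then have "homogeneous n ?c"
    using homogeneous_diff homogeneous_coeff z y(1) by (metis range_subsetD)
  moreover have "homogeneous (n + 1) ?c"
    by (intro homogeneous_sum homogeneous_mult homogeneous_svar homogeneous_coeff z)
  ultimately have "?c = 0"
    by (rule homogeneous_unique) simp
  then have "coeff (z k) = coeff (z undefined)" for k
    by (rule svar_relation)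
  then have "z k = z undefined" for k
    using z S_sub_subset_S_alg by (meson coeff_inj subsetD)
  then have "x = z undefined * (\<Sum>j\<in>UNIV. agen (Es j))"
    unfolding xz sum_distrib_left by (metis (no_types, lifting))
  then show "x \<in> S_sub n"
    using z by (simp add: sum_agen_Es)
qed

lemma F_sub_eq: "F_sub = S_alg"
proof
  show "F_sub \<subseteq> S_alg"
    unfolding F_sub_def Suc_eq_plus1[symmetric]
    using inter_subset_S_sub S_sub_subset_S_alg
    by (intro alg.span_minimal subspace_S_alg) blast
  show "S_alg \<subseteq> F_sub"
    unfolding S_alg_def F_sub_def Suc_eq_plus1[symmetric]
    by (rule alg.span_mono) (use sprod_in_A_sub in blast)
qed

theorem theorem8p6:
  fixes d :: nat
    and F A1 As1 :: "('i::finite, 'f::field) alg set"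
  assumes "d \<ge> 1" and "card (UNIV :: 'i set) = d + 1"
    and "F = F_sub" and "A1 = A_sub 1" and "As1 = As_sub 1"
  shows "(\<exists>\<phi>. tensor_linear ascale ascale ascale F A1 \<phi> \<and>
            (\<forall>u\<in>F. \<forall>v\<in>A1. \<phi> (pure_tensor ascale ascale F A1 u v) = u * v) \<and>
            bij_betw \<phi> (tensor_space ascale ascale F A1) UNIV) \<and>
         (\<exists>\<phi>. tensor_linear ascale ascale ascale F As1 \<phi> \<and>
            (\<forall>u\<in>F. \<forall>v\<in>As1. \<phi> (pure_tensor ascale ascale F As1 u v) = u * v) \<and>
            bij_betw \<phi> (tensor_space ascale ascale F As1) UNIV)"
proof -
  have F: "F = S_alg"
    by (simp add: assms(3) F_sub_eq)
  \<comment> \<open>The premise left open states that the right tensor factor is the span of the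
    family \<open>v\<close>; \<open>A_sub_1\<close> and \<open>As_sub_1\<close> supply it.\<close>
  note iso = tensor_iso_of_unique_expansion[OF vector_space_ascale vector_space_ascale
      vector_space_ascale subspace_S_alg, where f = "(*)",
      OF _ distrib_right distrib_left ascale_mult_left ascale_mult_right]
  show ?thesis
  proof
    show "\<exists>\<phi>. tensor_linear ascale ascale ascale F A1 \<phi> \<and>
            (\<forall>u\<in>F. \<forall>v\<in>A1. \<phi> (pure_tensor ascale ascale F A1 u v) = u * v) \<and>
            bij_betw \<phi> (tensor_space ascale ascale F A1) UNIV"
      unfolding F by (rule iso[where v = "\<lambda>j. agen (E j)", OF _ expansion_E independent_E])
        (simp_all only: assms(4) A_sub_1)
    show "\<exists>\<phi>. tensor_linear ascale ascale ascale F As1 \<phi> \<and>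
            (\<forall>u\<in>F. \<forall>v\<in>As1. \<phi> (pure_tensor ascale ascale F As1 u v) = u * v) \<and>
            bij_betw \<phi> (tensor_space ascale ascale F As1) UNIV"
      unfolding F by (rule iso[where v = "\<lambda>j. agen (Es j)", OF _ expansion_Es independent_Es])
        (simp_all only: assms(5) As_sub_1)
  qed
qed

end
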